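(* Let $C$ be any cyclic trigonal curve of genus $g\geq 16$ and let $i\in\{1,2\}$. Then for every $2\leq k\leq \lfloor\frac{n_i}{2}\rfloor$, $$\operatorname{rk}(\mu_{2k-1\mid \Lambda^2 W_i})=2n_i-4k+1,$$ $$\dim(\operatorname{Ker}(\mu_{2k-1\mid \Lambda^2 W_i}))=\frac{n_i(n_i-1)}{2}-k(2n_i-2k-1).$$ Moreover, if $k>\lfloor\frac{n_i}{2}\rfloor$, then $\operatorname{rk}(\mu_{2k-1\mid \Lambda^2 W_i})=0$.
   Context: A cyclic trigonal curve is the smooth projective complex curve $C$ with affine equation $y^3=\prod_{i=1}^{r_1}(x-t_i)\prod_{i=r_1+1}^{r_1+r_2}(x-t_i)^2$, where the $t_i$ are distinct complex numbers (normalized with $t_1=0$) and $r_1+2r_2\equiv 0 \pmod 3$. Put $r=r_1+r_2$; then $g=r-2$. Let $\pi:C\to\mathbb P^1$, $(x,y)\mapsto x$, let $L=\pi^*\mathcal O_{\mathbb P^1}(1)$ be the $g^1_3$ and $M=K_C\otimes L^\vee$. Identify $L\cong\mathcal O_C(F)$ with $F=\pi^*(0)$, so $H^0(M)$ is the space of holomorphic $1$-forms vanishing on $F$. Then $H^0(M)=W_1\oplus W_2$, where $$W_1=\Big\langle x^i\tfrac{dx}{y}: 1\le i\le n_1\Big\rangle,\qquad W_2=\Big\langle x^j\prod_{i=r_1+1}^{r}(x-t_i)\tfrac{dx}{y^2}: 1\le j\le n_2\Big\rangle,$$ $n_1=\frac{r_1+2r_2-6}{3}$, $n_2=\frac{2r_1+r_2-6}{3}$.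 Gaussian maps of $M$: let $\Delta\subset C\times C$ be the diagonal and identify $H^0(M)\otimes H^0(M)$ with $H^0(C\times C,M\boxtimes M)$. For $l\ge 0$, restriction to $\Delta$ gives a map $H^0((M\boxtimes M)(-l\Delta))\to H^0(C,M^{\otimes 2}\otimes K_C^{\otimes l})$ with kernel $H^0((M\boxtimes M)(-(l+1)\Delta))$. Antisymmetric tensors vanish to odd order along $\Delta$; restricting to $\Lambda^2H^0(M)$ yields $\mu_1=\mu_{1,M}:\Lambda^2H^0(M)\to H^0(M^{\otimes 2}\otimes K_C)$ and inductively $\mu_{2k-1}=\mu_{2k-1,M}:\operatorname{Ker}(\mu_{2k-3,M})\to H^0(M^{\otimes 2}\otimes K_C^{\otimes (2k-1)})$. The map $\mu_{2k-1|\Lambda^2W_i}$ is the restriction of $\mu_{2k-1}$ to $\operatorname{Ker}(\mu_{2k-3})\cap\Lambda^2W_i$ (to $\Lambda^2 W_i$ when $k=1$). *)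

theory Defs
  imports "HOL-Complex_Analysis.Complex_Analysis" "HOL-Library.Function_Algebras"
begin

section \<open>Complex-valued functions as a complex vector space\<close>

definition cscale :: "complex \<Rightarrow> ('i \<Rightarrow> complex) \<Rightarrow> 'i \<Rightarrow> complex" where
  "cscale c f = (\<lambda>i. c * f i)"

interpretation cfun: vector_space cscale
  by unfold_locales (auto simp: cscale_def fun_eq_iff algebra_simps)


section \<open>Riemann surfaces\<close>

text \<open>
  A chart is a pair of its domain \<open>U\<close> and its coordinate function. An atlas \<open>\<A>\<close> is a set of charts.
  Smooth projective complex curves are taken in the analytic category, as compact connected
  Riemann surfaces.
\<close>

type_synonym 'a chart = "'a set \<times> ('a \<Rightarrow> complex)"

definition cdom :: "'a chart \<Rightarrow> 'a set" where
  "cdom c = fst c"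

definition coord :: "'a chart \<Rightarrow> 'a \<Rightarrow> complex" where
  "coord c = snd c"

definition cimg :: "'a chart \<Rightarrow> complex set" where
  "cimg c = coord c ` cdom c"

definition param :: "'a chart \<Rightarrow> complex \<Rightarrow> 'a" where
  "param c = inv_into (cdom c) (coord c)"

definition compact_riemann_surface :: "'a topology \<Rightarrow> 'a chart set \<Rightarrow> bool" where
  "compact_riemann_surface X \<A> \<longleftrightarrow>
     compact_space X \<and> connected_space X \<and> Hausdorff_space X \<and>
     (\<Union>c\<in>\<A>. cdom c) = topspace X \<and>
     (\<forall>c\<in>\<A>. openin X (cdom c) \<and> open (cimg c) \<and>
        homeomorphic_map (subtopology X (cdom c)) (top_of_set (cimg c)) (coord c)) \<and>
     (\<forall>c\<in>\<A>. \<forall>d\<in>\<A>. (coord c \<circ> param d) holomorphic_on (coord d ` (cdom c \<inter> cdom d)))"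

text \<open>A meromorphic function is given the value 0 at its poles.\<close>

definition meromorphic_fun :: "'a chart set \<Rightarrow> ('a \<Rightarrow> complex) \<Rightarrow> bool" where
  "meromorphic_fun \<A> f \<longleftrightarrow> (\<forall>c\<in>\<A>. (f \<circ> param c) nicely_meromorphic_on (cimg c))"

definition poles :: "'a chart set \<Rightarrow> ('a \<Rightarrow> complex) \<Rightarrow> 'a set" where
  "poles \<A> f = {p. \<exists>c\<in>\<A>. p \<in> cdom c \<and> is_pole (f \<circ> param c) (coord c p)}"

text \<open>
  A 1-form \<open>\<omega>\<close> is the family of its coefficients: \<open>\<omega> = \<omega> (c, p) dz\<close> at the point \<open>p\<close> of the
  domain of the chart \<open>c\<close> with coordinate \<open>z\<close>. Coefficients outside the chart domains are set
  to 0. Sections of powers of the canonical bundle and tensors on the product of the surface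
  with itself are represented in the same way.
\<close>

type_synonym 'a form = "'a chart \<times> 'a \<Rightarrow> complex"
type_synonym 'a biform = "('a chart \<times> 'a) \<times> ('a chart \<times> 'a) \<Rightarrow> complex"

definition holomorphic_forms :: "'a chart set \<Rightarrow> 'a form set" where
  "holomorphic_forms \<A> = {\<omega>.
     (\<forall>c p. \<not> (c \<in> \<A> \<and> p \<in> cdom c) \<longrightarrow> \<omega> (c, p) = 0) \<and>
     (\<forall>c\<in>\<A>. (\<lambda>z. \<omega> (c, param c z)) holomorphic_on (cimg c)) \<and>
     (\<forall>c\<in>\<A>. \<forall>d\<in>\<A>. \<forall>p\<in>cdom c \<inter> cdom d.
        \<omega> (d, p) = \<omega> (c, p) * deriv (coord c \<circ> param d) (coord d p))}"

definition genus :: "'a chart set \<Rightarrow> nat" where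
  "genus \<A> = cfun.dim (holomorphic_forms \<A>)"

text \<open>
  The meromorphic form \<open>f dx\<close>, for meromorphic functions \<open>f\<close> and \<open>x\<close>. Removable singularities of
  its coefficients are filled in by continuity.
\<close>

definition diff_form :: "'a chart set \<Rightarrow> ('a \<Rightarrow> complex) \<Rightarrow> ('a \<Rightarrow> complex) \<Rightarrow> 'a form" where
  "diff_form \<A> f x = (\<lambda>(c, p). if c \<in> \<A> \<and> p \<in> cdom c
     then remove_sings (\<lambda>z. f (param c z) * deriv (x \<circ> param c) z) (coord c p) else 0)"


section \<open>Cyclic trigonal curves\<close>

text \<open>
  The smooth projective curve with affine equation
  \<open>y\<^sup>3 = \<Prod>(x - t\<^sub>i) \<Prod>(x - t\<^sub>i)\<^sup>2\<close>, up to isomorphism: a compact Riemann surface with meromorphic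
  functions \<open>x\<close> and \<open>y\<close> satisfying the equation, such that \<open>(x, y)\<close> identifies the part of the
  surface lying over the complement of the branch points \<open>t\<^sub>i\<close> and of infinity with the
  corresponding (smooth, Zariski open) part of the affine plane curve.
\<close>

definition trigonal_rhs :: "nat \<Rightarrow> nat \<Rightarrow> (nat \<Rightarrow> complex) \<Rightarrow> complex \<Rightarrow> complex" where
  "trigonal_rhs r1 r2 t a = (\<Prod>i\<in>{1..r1}. a - t i) * (\<Prod>i\<in>{r1+1..r1+r2}. (a - t i)^2)"

definition cyclic_trigonal_curve ::
  "nat \<Rightarrow> nat \<Rightarrow> (nat \<Rightarrow> complex) \<Rightarrow> 'a topology \<Rightarrow> 'a chart set \<Rightarrow>
     ('a \<Rightarrow> complex) \<Rightarrow> ('a \<Rightarrow> complex) \<Rightarrow> bool" where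
  "cyclic_trigonal_curve r1 r2 t X \<A> x y \<longleftrightarrow>
     inj_on t {1..r1+r2} \<and> t 1 = 0 \<and> 3 dvd (r1 + 2 * r2) \<and>
     compact_riemann_surface X \<A> \<and> meromorphic_fun \<A> x \<and> meromorphic_fun \<A> y \<and>
     (\<forall>p\<in>topspace X - poles \<A> x. y p ^ 3 = trigonal_rhs r1 r2 t (x p)) \<and>
     bij_betw (\<lambda>p. (x p, y p))
       {p \<in> topspace X - poles \<A> x. x p \<notin> t ` {1..r1+r2}}
       {(a, b). a \<notin> t ` {1..r1+r2} \<and> b ^ 3 = trigonal_rhs r1 r2 t a}"

text \<open>
  The space \<open>H\<^sup>0(M)\<close> of holomorphic 1-forms vanishing on the divisor \<open>F = \<pi>\<^sup>*(0)\<close>, where \<open>\<pi>\<close> is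
  the map given by \<open>x\<close>: away from the poles of \<open>x\<close>, which do not meet \<open>F\<close>, a local equation of
  \<open>F\<close> is \<open>x\<close>.
\<close>

definition H0_M :: "'a chart set \<Rightarrow> ('a \<Rightarrow> complex) \<Rightarrow> 'a form set" where
  "H0_M \<A> x = {\<omega> \<in> holomorphic_forms \<A>.
     \<forall>c\<in>\<A>. \<exists>h. h holomorphic_on (coord c ` (cdom c - poles \<A> x)) \<and>
       (\<forall>p\<in>cdom c - poles \<A> x. \<omega> (c, p) = x p * h (coord c p))}"

text \<open>
  When the genus is at least 2, so that \<open>r1 + r2 \<ge> 4\<close>, one has \<open>r1 + 2 r2 \<ge> 6\<close> and
  \<open>2 r1 + r2 \<ge> 6\<close>, and the subtractions are not truncated.
\<close>

definition n_W :: "nat \<Rightarrow> nat \<Rightarrow> nat \<Rightarrow> nat" where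
  "n_W r1 r2 i = (if i = 1 then (r1 + 2 * r2 - 6) div 3 else (2 * r1 + r2 - 6) div 3)"

definition W :: "nat \<Rightarrow> nat \<Rightarrow> (nat \<Rightarrow> complex) \<Rightarrow> 'a chart set \<Rightarrow>
    ('a \<Rightarrow> complex) \<Rightarrow> ('a \<Rightarrow> complex) \<Rightarrow> nat \<Rightarrow> 'a form set" where
  "W r1 r2 t \<A> x y i =
     (if i = 1
      then cfun.span ((\<lambda>j. diff_form \<A> (\<lambda>p. x p ^ j / y p) x) ` {1..n_W r1 r2 1})
      else cfun.span ((\<lambda>j. diff_form \<A>
             (\<lambda>p. x p ^ j * (\<Prod>m\<in>{r1+1..r1+r2}. x p - t m) / y p ^ 2) x) ` {1..n_W r1 r2 2}))"


section \<open>Gaussian maps\<close>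

text \<open>
  \<open>\<Lambda>\<^sup>2V\<close> consists of the antisymmetric tensors in \<open>V \<otimes> V\<close>, where \<open>\<omega> \<otimes> \<eta>\<close> is the section
  \<open>(p, q) \<mapsto> \<omega>(p) \<eta>(q)\<close> on the product of the surface with itself.
\<close>

definition wedge :: "'a form \<Rightarrow> 'a form \<Rightarrow> 'a biform" where
  "wedge \<omega> \<eta> = (\<lambda>(a, b). \<omega> a * \<eta> b - \<eta> a * \<omega> b)"

definition Lambda2 :: "'a form set \<Rightarrow> 'a biform set" where
  "Lambda2 V = cfun.span {wedge \<omega> \<eta> | \<omega> \<eta>. \<omega> \<in> V \<and> \<eta> \<in> V}"

text \<open>
  Restriction to the diagonal of a section \<open>T\<close> vanishing to order \<open>l\<close> along it. In a local
  coordinate \<open>z\<close>, \<open>T = (z - w)\<^sup>l h(z, w) dz dw\<close> with \<open>h\<close> holomorphic, and the restriction is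
  \<open>h(z, z) (dz)\<^bsup>l+2\<^esup>\<close>; the value \<open>h(z, z)\<close> is obtained as the limit of \<open>h(z, w)\<close> for \<open>w\<close>
  tending to \<open>z\<close>. As \<open>M = K(-F)\<close> is a subsheaf of \<open>K\<close>, the target \<open>H\<^sup>0(M\<^sup>2 \<otimes> K\<^sup>l)\<close> is
  regarded as a space of sections of \<open>K\<^bsup>l+2\<^esup>\<close>.
\<close>

definition diag_restrict :: "'a chart set \<Rightarrow> nat \<Rightarrow> 'a biform \<Rightarrow> 'a form" where
  "diag_restrict \<A> l T = (\<lambda>(c, p). if c \<in> \<A> \<and> p \<in> cdom c
     then Lim (at (coord c p)) (\<lambda>w. T ((c, p), (c, param c w)) / (coord c p - w) ^ l) else 0)"

text \<open>
  \<open>gauss_ker \<A> x k\<close> is the kernel of \<open>\<mu>\<^bsub>2k-1\<^esub>\<close> for \<open>k \<ge> 1\<close>, and \<open>\<Lambda>\<^sup>2H\<^sup>0(M)\<close> for \<open>k = 0\<close>. The domain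
  of \<open>\<mu>\<^bsub>2k+1\<^esub>\<close> is therefore \<open>gauss_ker \<A> x k\<close>; its elements vanish to order \<open>2k+1\<close> along the
  diagonal, because antisymmetric tensors vanish to odd order.
\<close>

primrec gauss_ker :: "'a chart set \<Rightarrow> ('a \<Rightarrow> complex) \<Rightarrow> nat \<Rightarrow> 'a biform set" where
  "gauss_ker \<A> x 0 = Lambda2 (H0_M \<A> x)"
| "gauss_ker \<A> x (Suc k) = {T \<in> gauss_ker \<A> x k. diag_restrict \<A> (2 * k + 1) T = 0}"

text \<open>Domain, rank and kernel of the restriction of \<open>\<mu>\<^bsub>2k-1\<^esub>\<close> to \<open>\<Lambda>\<^sup>2V\<close>, for \<open>k \<ge> 1\<close>.\<close>

definition mu_dom :: "'a chart set \<Rightarrow> ('a \<Rightarrow> complex) \<Rightarrow> nat \<Rightarrow> 'a form set \<Rightarrow> 'a biform set" where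
  "mu_dom \<A> x k V = gauss_ker \<A> x (k - 1) \<inter> Lambda2 V"

definition mu_rank :: "'a chart set \<Rightarrow> ('a \<Rightarrow> complex) \<Rightarrow> nat \<Rightarrow> 'a form set \<Rightarrow> nat" where
  "mu_rank \<A> x k V = cfun.dim (diag_restrict \<A> (2 * k - 1) ` mu_dom \<A> x k V)"

definition mu_ker :: "'a chart set \<Rightarrow> ('a \<Rightarrow> complex) \<Rightarrow> nat \<Rightarrow> 'a form set \<Rightarrow> 'a biform set" where
  "mu_ker \<A> x k V = {T \<in> mu_dom \<A> x k V. diag_restrict \<A> (2 * k - 1) T = 0}"

end

theory Submission
  imports Defs
begin

text \<open>
  Put \<open>\<psi> = 1/y\<close> for \<open>i = 1\<close> and \<open>\<psi> = \<Prod>(x - t\<^sub>m)/y\<^sup>2\<close> (over the double roots) for \<open>i = 2\<close>, and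
  \<open>\<omega>\<^sub>j = x\<^sup>j \<psi> dx\<close>. Then \<open>W\<^sub>i\<close> is spanned by \<open>\<omega>\<^sub>1, \<dots>, \<omega>\<^sub>n\<close>, and an element of \<open>\<Lambda>\<^sup>2W\<^sub>i\<close> has the form
  \<open>P(x(p), x(q)) \<omega>\<^sub>0(p) \<omega>\<^sub>0(q)\<close> with an antisymmetric polynomial \<open>P(u, v)\<close> whose exponents lie between
  1 and \<open>n\<close>. Outside a discrete set \<open>x\<close> is a local coordinate and \<open>\<omega>\<^sub>0\<close> has neither zero nor pole, so the
  order of vanishing along the diagonal is the exponent of \<open>u - v\<close> in \<open>P\<close>. The domain of
  \<open>\<mu>\<^bsub>2k-1\<^esub>\<close> therefore corresponds to the polynomials \<open>u v (u - v)\<^bsup>2k-1\<^esup> S\<close> with \<open>S\<close> symmetric of degree at most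
  \<open>n - 2k\<close> in each variable, and \<open>\<mu>\<^bsub>2k-1\<^esub>\<close> sends such an element to \<open>S(u, u)\<close> times a fixed nonzero factor.
  As \<open>S\<close> varies, \<open>S(u, u)\<close> runs through all polynomials of degree at most \<open>2(n - 2k)\<close>, which gives the
  rank; the kernel corresponds to the symmetric \<open>S\<close> of degree at most \<open>n - 2k - 2\<close> in each variable, which
  gives its dimension.

  To make this explicit, choose for every \<open>d \<le> 2(n - 2m)\<close> one symmetric polynomial \<open>B\<^sub>d\<close> with
  \<open>B\<^sub>d(u, u) = 2u\<^sup>d\<close>, namely the symmetrization of \<open>u\<^bsup>\<lceil>d/2\<rceil>\<^esup> v\<^bsup>\<lfloor>d/2\<rfloor>\<^esup>\<close>. The products \<open>u v (u - v)\<^bsup>2m-1\<^esup> B\<^sub>d\<close> span the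
  antisymmetric polynomials (\<open>antisym_in_span_gauss_basis\<close>), and the leading terms of the
  corresponding tensors along the diagonal are independent for each fixed \<open>m\<close>
  (\<open>symbols_independent\<close>). The kernels of all \<open>\<mu>\<^bsub>2k-1\<^esub>\<close> are then spanned by
  parts of one basis (\<open>kernel_on_level\<close>), and the theorem follows by counting.

  The geometric input is that \<open>\<omega>\<^sub>1, \<dots>, \<omega>\<^sub>n\<close> are holomorphic and divisible by \<open>x\<close>
  (\<open>form_in_H0_M\<close>). Both functions \<open>\<psi>\<close> satisfy \<open>\<psi>\<^sup>3 D(x) = 1\<close> for a polynomial \<open>D\<close> all of
  whose roots have multiplicity at most 2 and whose degree exceeds \<open>3n + 3\<close>. In a local coordinate \<open>z\<close>
  at a point with \<open>x = a\<close>, the cube of \<open>(z - z\<^sub>0) x\<^sup>j \<psi> x'\<close> is the cube of the logarithmic derivative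
  \<open>(z - z\<^sub>0) x'/(x - a)\<close>, which is bounded, times \<open>(x - a)\<^sup>3 x\<^bsup>3j\<^esup>/D(x)\<close>, which tends to 0 both for \<open>x \<rightarrow> a\<close>
  and, with \<open>a = 0\<close> in the logarithmic derivative, for \<open>x \<rightarrow> \<infinity>\<close>. Riemann's theorem on removable
  singularities applies (\<open>analytic_cyclic_differential\<close>).
\<close>

section \<open>Multiplying tensors by the equation of the diagonal\<close>

text \<open>
  The tensor \<open>s a b\<close> stands for the monomial \<open>u\<^sup>a v\<^sup>b\<close>, and \<open>diag_mult l s a b\<close> for \<open>(u - v)\<^sup>l u\<^sup>a v\<^sup>b\<close>. The
  multiplication is carried out on exponents, because over a pole of \<open>x\<close> the tensors are not
  values of a polynomial in \<open>x(p)\<close> and \<open>x(q)\<close>.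
\<close>

primrec diag_mult :: "nat \<Rightarrow> (nat \<Rightarrow> nat \<Rightarrow> 'b::ab_group_add) \<Rightarrow> nat \<Rightarrow> nat \<Rightarrow> 'b" where
  "diag_mult 0 s a b = s a b"
| "diag_mult (Suc l) s a b = diag_mult l s (Suc a) b - diag_mult l s a (Suc b)"

text \<open>
  The product \<open>(u - v)\<^sup>l (u\<^sup>a v\<^sup>b + u\<^sup>b v\<^sup>a)\<close>; for odd \<open>l\<close> it is antisymmetric.
\<close>

definition sym_mult :: "nat \<Rightarrow> (nat \<Rightarrow> nat \<Rightarrow> 'b::ab_group_add) \<Rightarrow> nat \<Rightarrow> nat \<Rightarrow> 'b" where
  "sym_mult l s a b = diag_mult l s a b + diag_mult l s b a"

lemma sym_mult_commute: "sym_mult l s a b = sym_mult l s b a"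
  by (simp add: sym_mult_def add.commute)

lemma sym_mult_Suc_Suc:
  "sym_mult (Suc (Suc l)) s a b =
     sym_mult l s (a + 2) b - (sym_mult l s (a + 1) (b + 1) + sym_mult l s (a + 1) (b + 1))
       + sym_mult l s a (b + 2)"
  by (simp add: sym_mult_def algebra_simps)

text \<open>
  This is \<open>(u v)\<^sup>b (u\<^sup>m - v\<^sup>m)\<close> divided by \<open>u - v\<close>, with the quotient symmetrized. The left-hand side is doubled to stay within
  abelian groups.
\<close>

lemma antisym_eq_sum_sym_mult:
  fixes s :: "nat \<Rightarrow> nat \<Rightarrow> 'b::ab_group_add"
  shows "(s (b + m) b - s b (b + m)) + (s (b + m) b - s b (b + m)) =
     (\<Sum>q<m. sym_mult 1 s (b + (m - 1 - q)) (b + q))"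
proof -
  define h where "h = (\<lambda>q. s (b + (m - q)) (b + q))"
  have 1: "(\<Sum>q<m. diag_mult 1 s (b + (m - 1 - q)) (b + q)) = s (b + m) b - s b (b + m)"
  proof -
    have "(\<Sum>q<m. diag_mult 1 s (b + (m - 1 - q)) (b + q)) = (\<Sum>q<m. h q - h (Suc q))"
      by (rule sum.cong) (auto simp: h_def Suc_diff_Suc simp flip: add_Suc_right)
    also have "\<dots> = h 0 - h m"
      by (rule sum_lessThan_telescope')
    finally show ?thesis by (simp add: h_def)
  qed
  have "(\<Sum>q<m. diag_mult 1 s (b + q) (b + (m - 1 - q))) =
        (\<Sum>q<m. diag_mult 1 s (b + (m - 1 - q)) (b + q))"
    by (rule sum.reindex_bij_witness[where i = "\<lambda>q. m - 1 - q" and j = "\<lambda>q. m - 1 - q"]) auto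
  then show ?thesis
    by (simp only: sym_mult_def sum.distrib 1)
qed

text \<open>
  The index \<open>(m, d)\<close> refers to \<open>u v (u - v)\<^bsup>2m-1\<^esup> B\<^sub>d\<close>. The bound on \<open>d\<close> says that both exponents of
  \<open>u v B\<^sub>d\<close> are at most \<open>n - (2m - 1)\<close>.
\<close>

definition gauss_index :: "nat \<Rightarrow> nat \<Rightarrow> (nat \<times> nat) set" where
  "gauss_index n k = {(m, d). 1 \<le> m \<and> k \<le> m \<and> 2 * m \<le> n \<and> d \<le> 2 * (n - 2 * m)}"

definition gauss_basis :: "(nat \<Rightarrow> nat \<Rightarrow> 'b::ab_group_add) \<Rightarrow> nat \<times> nat \<Rightarrow> 'b" where
  "gauss_basis s = (\<lambda>(m, d). sym_mult (2 * m - 1) s (1 + (d + 1) div 2) (1 + d div 2))"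

lemma finite_gauss_index [simp]: "finite (gauss_index n k)"
proof (rule finite_subset)
  show "gauss_index n k \<subseteq> {..n} \<times> {..2 * n}"
    by (auto simp: gauss_index_def)
qed simp

text \<open>
  Symmetrized monomials with \<open>a - b \<le> 1\<close> belong to the family. For the others, expanding \<open>(u - v)\<^sup>2\<close>
  expresses \<open>u\<^sup>a v\<^sup>b\<close> by a product with a higher power of \<open>u - v\<close> and by monomials whose exponents
  are closer to each other, so that induction on \<open>a - b\<close> applies. For \<open>a - b \<le> 3\<close> one of these
  monomials has its exponents in the reverse order, and the symmetry is used.
\<close>

lemma sym_mult_in_span:
  fixes s :: "nat \<Rightarrow> nat \<Rightarrow> 'i \<Rightarrow> complex"
  assumes "odd l" "1 \<le> b" "b \<le> a" "a + l \<le> n"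
  shows "sym_mult l s a b \<in> cfun.span (gauss_basis s ` gauss_index n 1)"
  using assms
proof (induction "a - b" arbitrary: a b l rule: less_induct)
  case less
  let ?S = "cfun.span (gauss_basis s ` gauss_index n 1)"
  consider "a \<le> b + 1" | "a = b + 2" | "a = b + 3" | "a \<ge> b + 4" by linarith
  then show ?case
  proof cases
    case 1
    \<comment> \<open>Here \<open>{a, b}\<close> is \<open>{1 + \<lceil>d/2\<rceil>, 1 + \<lfloor>d/2\<rfloor>}\<close>, so the product is itself a member of the family.\<close>
    define m d where "m = (l + 1) div 2" and "d = a + b - 2"
    have l: "l = 2 * m - 1" "1 \<le> m" using less.prems(1) by (auto simp: m_def elim: oddE)
    have ab: "a = 1 + (d + 1) div 2" "b = 1 + d div 2" 
      using 1 less.prems by (auto simp: d_def)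
    have "(m, d) \<in> gauss_index n 1"
      using less.prems 1 l by (auto simp: gauss_index_def d_def)
    then have "gauss_basis s (m, d) \<in> ?S"
      by (intro cfun.span_base imageI)
    then show ?thesis using l ab by (simp add: gauss_basis_def)
  next
    case 2
    have e: "sym_mult (Suc (Suc l)) s b b = sym_mult l s a b 
       - (sym_mult l s (b + 1) (b + 1) + sym_mult l s (b + 1) (b + 1)) + sym_mult l s a b"
      using 2 sym_mult_Suc_Suc[of l s b b] sym_mult_commute[of l s b "b + 2"] by simp
    have "sym_mult (Suc (Suc l)) s b b \<in> ?S" "sym_mult l s (b + 1) (b + 1) \<in> ?S"
      using less.hyps[of b b "Suc (Suc l)"] less.hyps[of "b + 1" "b + 1" l] less.prems 2 by auto
    then have "cscale (1/2) (sym_mult (Suc (Suc l)) s b b 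
        + (sym_mult l s (b + 1) (b + 1) + sym_mult l s (b + 1) (b + 1))) \<in> ?S"
      by (intro cfun.span_scale cfun.span_add)
    also have "cscale (1/2) (sym_mult (Suc (Suc l)) s b b 
        + (sym_mult l s (b + 1) (b + 1) + sym_mult l s (b + 1) (b + 1))) = sym_mult l s a b"
      unfolding e by (auto simp: fun_eq_iff cscale_def)
    finally show ?thesis .
  next
    case 3
    have "sym_mult l s a b = sym_mult (Suc (Suc l)) s (b + 1) b 
       + (sym_mult l s (b + 2) (b + 1) + sym_mult l s (b + 2) (b + 1)) - sym_mult l s (b + 2) (b + 1)"
      using 3 sym_mult_Suc_Suc[of l s "b + 1" b] sym_mult_commute[of l s "b + 1" "b + 2"]
      by (simp add: numeral_3_eq_3)
    moreover have "sym_mult (Suc (Suc l)) s (b + 1) b \<in> ?S" "sym_mult l s (b + 2) (b + 1) \<in> ?S"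
      using less.hyps[of "b + 1" b "Suc (Suc l)"] less.hyps[of "b + 2" "b + 1" l] less.prems 3 by auto
    ultimately show ?thesis
      by (simp only: cfun.span_add cfun.span_diff)
  next
    case 4
    obtain a' where a': "a = a' + 2" using 4 by (metis add.commute le_Suc_ex le_add1 numeral_Bit0 add_leE)
    have "sym_mult l s a b = sym_mult (Suc (Suc l)) s a' b
       + (sym_mult l s (a' + 1) (b + 1) + sym_mult l s (a' + 1) (b + 1)) - sym_mult l s a' (b + 2)"
      using sym_mult_Suc_Suc[of l s a' b] a' by simp
    moreover have "sym_mult (Suc (Suc l)) s a' b \<in> ?S" "sym_mult l s (a' + 1) (b + 1) \<in> ?S"
      "sym_mult l s a' (b + 2) \<in> ?S"
      using less.hyps[of a' b "Suc (Suc l)"] less.hyps[of "a' + 1" "b + 1" l]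
         less.hyps[of a' "b + 2" l] less.prems 4 a' by auto
    ultimately show ?thesis
      by (simp only: cfun.span_add cfun.span_diff)
  qed
qed

lemma antisym_in_span_gauss_basis:
  fixes s :: "nat \<Rightarrow> nat \<Rightarrow> 'i \<Rightarrow> complex"
  assumes "i \<in> {1..n}" "j \<in> {1..n}"
  shows "s i j - s j i \<in> cfun.span (gauss_basis s ` gauss_index n 1)"
  using assms
proof (induction i j rule: linorder_wlog)
  case (sym j i)
  have "s i j - s j i \<in> cfun.span (gauss_basis s ` gauss_index n 1)"
    by (rule sym.IH) (use sym.prems in auto)
  then have "- (s i j - s j i) \<in> cfun.span (gauss_basis s ` gauss_index n 1)"
    by (rule cfun.span_neg)
  then show ?case by (simp only: minus_diff_eq)
next
  case (le j i)
  define m where "m = i - j"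
  have i: "i = j + m" using le by (simp add: m_def)
  have "sym_mult 1 s (j + (m - 1 - q)) (j + q) \<in> cfun.span (gauss_basis s ` gauss_index n 1)" if "q < m" for q
    using sym_mult_in_span[of 1 "j + q" "j + (m - 1 - q)" n s]
      sym_mult_in_span[of 1 "j + (m - 1 - q)" "j + q" n s] sym_mult_commute[of 1 s "j + (m - 1 - q)" "j + q"] le that i
    by (cases "j + q \<le> j + (m - 1 - q)") auto
  then have "cscale (-1/2) ((s (j + m) j - s j (j + m)) + (s (j + m) j - s j (j + m))) \<in> 
      cfun.span (gauss_basis s ` gauss_index n 1)"
    unfolding antisym_eq_sum_sym_mult by (intro cfun.span_scale cfun.span_sum) auto
  also have "cscale (-1/2) ((s (j + m) j - s j (j + m)) + (s (j + m) j - s j (j + m))) = s j i - s i j"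
    unfolding i by (auto simp: fun_eq_iff cscale_def field_simps)
  finally show ?case .
qed

lemma sym_mult_in_subspace:
  fixes s :: "nat \<Rightarrow> nat \<Rightarrow> 'i \<Rightarrow> complex"
  assumes V: "cfun.subspace V" and s: "\<And>i j. i \<in> {1..n} \<Longrightarrow> j \<in> {1..n} \<Longrightarrow> s i j - s j i \<in> V"
    and "odd l" "1 \<le> a" "1 \<le> b" "a + l \<le> n" "b + l \<le> n"
  shows "sym_mult l s a b \<in> V"
  using assms(3-)
proof (induction l arbitrary: a b rule: less_induct)
  case (less l)
  show ?case
  proof (cases "l = 1")
    case True
    have "sym_mult l s a b = (s (Suc a) b - s b (Suc a)) + (s (Suc b) a - s a (Suc b))"
      by (simp add: True sym_mult_def)
    then show ?thesis
      using less.prems True by (simp only: cfun.subspace_add[OF V] s) (intro cfun.subspace_add[OF V] s; simp)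
  next
    case False
    then obtain l' where l': "l = Suc (Suc l')" "odd l'"
      using less.prems(1) by (metis One_nat_def even_Suc even_zero not0_implies_Suc)
    have "sym_mult l' s a' b' \<in> V" if "1 \<le> a'" "1 \<le> b'" "a' \<le> a + 2" "b' \<le> b + 2" for a' b'
      using less.IH[of l' a' b'] l' that less.prems by auto
    then show ?thesis
      unfolding l' sym_mult_Suc_Suc 
      by (intro cfun.subspace_add[OF V] cfun.subspace_diff[OF V]) (use less.prems in auto)
  qed
qed

lemma gauss_basis_in_subspace:
  fixes s :: "nat \<Rightarrow> nat \<Rightarrow> 'i \<Rightarrow> complex"
  assumes V: "cfun.subspace V" and s: "\<And>i j. i \<in> {1..n} \<Longrightarrow> j \<in> {1..n} \<Longrightarrow> s i j - s j i \<in> V"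
    and "e \<in> gauss_index n k"
  shows "gauss_basis s e \<in> V"
  using assms(3) by (auto simp: gauss_index_def gauss_basis_def intro!: sym_mult_in_subspace[OF V s])

lemma card_gauss_index_section:
  assumes "1 \<le> k"
  shows "card {e \<in> gauss_index n k. fst e = k} = (if 2 * k \<le> n then 2 * (n - 2 * k) + 1 else 0)"
proof -
  have "{e \<in> gauss_index n k. fst e = k} = (if 2 * k \<le> n then {k} \<times> {..2 * (n - 2 * k)} else {})"
    using assms by (auto simp: gauss_index_def)
  then show ?thesis by simp
qed

text \<open>
  The levels \<open>m = k, k + 1, \<dots>\<close> contribute \<open>2(n - 2m) + 1\<close> elements each. The bound on \<open>k\<close> excludes the
  range in which the product on the right is positive although no index is left.
\<close>

lemma card_gauss_index:
  assumes "1 \<le> k" "2 * k \<le> n + 2"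
  shows "2 * int (card (gauss_index n k)) = (int n + 2 - 2 * int k) * (int n + 1 - 2 * int k)"
  using assms
proof (induction "n + 2 - 2 * k" arbitrary: k rule: less_induct)
  case less
  show ?case
  proof (cases "2 * k \<le> n")
    case False
    then have "gauss_index n k = {}" by (auto simp: gauss_index_def)
    moreover have "2 * k = n + 1 \<or> 2 * k = n + 2" using less.prems False by linarith
    then have "2 * int k = int n + 1 \<or> 2 * int k = int n + 2" by linarith
    ultimately show ?thesis by auto
  next
    case True
    have "gauss_index n k = {e \<in> gauss_index n k. fst e = k} \<union> gauss_index n (Suc k)"
      using less.prems by (auto simp: gauss_index_def)
    then have "card (gauss_index n k) = card ({e \<in> gauss_index n k. fst e = k} \<union> gauss_index n (Suc k))"
      by simp
    also have "\<dots> = card {e \<in> gauss_index n k. fst e = k} + card (gauss_index n (Suc k))"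
      by (intro card_Un_disjoint) (auto simp: gauss_index_def intro: finite_subset[OF _ finite_gauss_index])
    finally have "int (card (gauss_index n k)) = 2 * (int n - 2 * int k) + 1 + int (card (gauss_index n (Suc k)))"
      using True less.prems by (simp add: card_gauss_index_section of_nat_diff)
    moreover have "2 * int (card (gauss_index n (Suc k))) = (int n + 2 - 2 * int (Suc k)) * (int n + 1 - 2 * int (Suc k))"
      using less.hyps[of "Suc k"] less.prems True by auto
    ultimately show ?thesis by (simp add: algebra_simps)
  qed
qed

lemma span_image_sum:
  assumes "finite J" "v \<in> cfun.span (T ` J)"
  shows "\<exists>c. v = (\<Sum>e\<in>J. cscale (c e) (T e))"
  using assms(2)
proof (induction rule: cfun.span_induct_alt)
  case base
  show ?case by (rule exI[of _ "\<lambda>_. 0"]) simp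
next
  case (step a w v)
  then obtain e c where e: "e \<in> J" "w = T e" "v = (\<Sum>e\<in>J. cscale (c e) (T e))" by auto
  have "(\<Sum>e'\<in>J. cscale (c e' + (if e' = e then a else 0)) (T e')) = 
     (\<Sum>e'\<in>J. cscale (c e') (T e') + (if e' = e then cscale a (T e) else 0))"
    by (rule sum.cong) (auto simp: cfun.scale_left_distrib)
  also have "\<dots> = cscale a w + v"
    using e assms(1) by (simp add: sum.distrib)
  finally show ?case by metis
qed

lemma dim_span_family:
  assumes J: "finite J" and ind: "\<And>c. (\<Sum>e\<in>J. cscale (c e) (T e)) = 0 \<Longrightarrow> \<forall>e\<in>J. c e = 0"
  shows "cfun.dim (cfun.span (T ` J)) = card J"
proof -
  have inj: "inj_on T J"
  proof (rule inj_onI, rule ccontr)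
    fix e e' assume e: "e \<in> J" "e' \<in> J" "T e = T e'" "e \<noteq> e'"
    define c :: "'a \<Rightarrow> complex" where "c = (\<lambda>u. if u = e then 1 else if u = e' then -1 else 0)"
    have "(\<Sum>u\<in>J. cscale (c u) (T u)) = (\<Sum>u\<in>{e, e'}. cscale (c u) (T u))"
      using e J by (intro sum.mono_neutral_right) (auto simp: c_def)
    also have "\<dots> = 0" using e by (simp add: c_def)
    finally show False using ind[of c] e(1) by (auto simp: c_def)
  qed
  have "cfun.independent (T ` J)"
  proof (rule cfun.independent_if_scalars_zero)
    fix g v assume g: "(\<Sum>v\<in>T ` J. cscale (g v) v) = 0" "v \<in> T ` J"
    then have "(\<Sum>e\<in>J. cscale (g (T e)) (T e)) = 0" by (simp add: sum.reindex[OF inj])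
    with ind[of "\<lambda>e. g (T e)"] g(2) show "g v = 0" by auto
  qed (use J in simp)
  then show ?thesis
    using cfun.dim_span_eq_card_independent card_image[OF inj] by metis
qed

text \<open>
  The first coordinate of an index is the order of vanishing. The map \<open>\<delta> k\<close> is controlled only on
  combinations of vectors of order at least \<open>k\<close>, where it reads off the leading part; this partial
  linearity is what restriction to the diagonal satisfies, since limits need not exist elsewhere.
\<close>

locale filtered_family =
  fixes J :: "(nat \<times> 'd) set" and T :: "nat \<times> 'd \<Rightarrow> 'i \<Rightarrow> complex"
    and G :: "nat \<times> 'd \<Rightarrow> 'j \<Rightarrow> complex" and \<delta> :: "nat \<Rightarrow> ('i \<Rightarrow> complex) \<Rightarrow> 'j \<Rightarrow> complex"
  assumes finite_J: "finite J" and pos_J: "\<And>e. e \<in> J \<Longrightarrow> 1 \<le> fst e"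
    and leading: "\<And>k c. 1 \<le> k \<Longrightarrow> \<delta> k (\<Sum>e\<in>{e \<in> J. k \<le> fst e}. cscale (c e) (T e)) =
        (\<Sum>e\<in>{e \<in> J. fst e = k}. cscale (c e) (G e))"
    and leading_indep: "\<And>k c. (\<Sum>e\<in>{e \<in> J. fst e = k}. cscale (c e) (G e)) = 0 \<Longrightarrow>
        \<forall>e\<in>{e \<in> J. fst e = k}. c e = 0"
begin

definition level :: "nat \<Rightarrow> ('i \<Rightarrow> complex) set" where
  "level k = cfun.span (T ` {e \<in> J. k \<le> fst e})"

lemma subspace_level: "cfun.subspace (level k)"
  by (simp add: level_def)

lemma level_cases:
  assumes "v \<in> level k"
  obtains c where "v = (\<Sum>e\<in>{e \<in> J. k \<le> fst e}. cscale (c e) (T e))"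
  using assms span_image_sum[of "{e \<in> J. k \<le> fst e}" v T] finite_J by (auto simp: level_def)

lemma sum_in_level: "(\<Sum>e\<in>{e \<in> J. k \<le> fst e}. cscale (c e) (T e)) \<in> level k"
  unfolding level_def by (intro cfun.span_sum cfun.span_scale cfun.span_base) auto

lemma split_level:
  assumes "\<And>e. e \<in> J \<Longrightarrow> fst e = k \<Longrightarrow> c e = 0"
  shows "(\<Sum>e\<in>{e \<in> J. k \<le> fst e}. cscale (c e) (T e)) = (\<Sum>e\<in>{e \<in> J. Suc k \<le> fst e}. cscale (c e) (T e))"
proof (rule sum.mono_neutral_right)
  show "\<forall>i\<in>{e \<in> J. k \<le> fst e} - {e \<in> J. Suc k \<le> fst e}. cscale (c i) (T i) = 0"
    using assms by (auto simp: le_eq_less_or_eq Suc_le_eq)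
qed (use finite_J in auto)

lemma kernel_on_level:
  assumes "1 \<le> k"
  shows "{v \<in> level k. \<delta> k v = 0} = level (Suc k)"
proof (intro equalityI subsetI)
  fix v assume v: "v \<in> {v \<in> level k. \<delta> k v = 0}"
  then obtain c where c: "v = (\<Sum>e\<in>{e \<in> J. k \<le> fst e}. cscale (c e) (T e))"
    by (auto elim: level_cases)
  have "\<forall>e\<in>{e \<in> J. fst e = k}. c e = 0"
    using v leading[OF assms, of c] leading_indep[where c=c] c by auto
  then have "v = (\<Sum>e\<in>{e \<in> J. Suc k \<le> fst e}. cscale (c e) (T e))"
    unfolding c by (intro split_level) auto
  then show "v \<in> level (Suc k)" using sum_in_level by simp
next
  fix v assume "v \<in> level (Suc k)"
  then obtain c where c: "v = (\<Sum>e\<in>{e \<in> J. Suc k \<le> fst e}. cscale (c e) (T e))"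
    by (auto elim: level_cases)
  define c' where "c' = (\<lambda>e. if fst e = k then 0 else c e)"
  have "v = (\<Sum>e\<in>{e \<in> J. Suc k \<le> fst e}. cscale (c' e) (T e))"
    unfolding c by (rule sum.cong) (auto simp: c'_def)
  also have "\<dots> = (\<Sum>e\<in>{e \<in> J. k \<le> fst e}. cscale (c' e) (T e))"
    by (rule split_level[symmetric]) (auto simp: c'_def)
  finally have v: "v = (\<Sum>e\<in>{e \<in> J. k \<le> fst e}. cscale (c' e) (T e))" .
  have "\<delta> k v = 0" 
    unfolding v leading[OF assms] by (rule sum.neutral) (auto simp: c'_def)
  then show "v \<in> {v \<in> level k. \<delta> k v = 0}"
    using v sum_in_level by simp
qed

lemma dim_leading_image:
  assumes "1 \<le> k"
  shows "cfun.dim (\<delta> k ` level k) = card {e \<in> J. fst e = k}"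
proof -
  have "\<delta> k ` level k = cfun.span (G ` {e \<in> J. fst e = k})"
  proof (intro equalityI subsetI)
    fix w assume "w \<in> \<delta> k ` level k"
    then obtain c where "w = \<delta> k (\<Sum>e\<in>{e \<in> J. k \<le> fst e}. cscale (c e) (T e))"
      by (auto elim: level_cases)
    then show "w \<in> cfun.span (G ` {e \<in> J. fst e = k})"
      unfolding leading[OF assms] by (auto intro!: cfun.span_sum cfun.span_scale intro: cfun.span_base)
  next
    fix w assume "w \<in> cfun.span (G ` {e \<in> J. fst e = k})"
    then obtain c where "w = (\<Sum>e\<in>{e \<in> J. fst e = k}. cscale (c e) (G e))"
      using span_image_sum[of "{e \<in> J. fst e = k}" w G] finite_J by auto
    then have "w = \<delta> k (\<Sum>e\<in>{e \<in> J. k \<le> fst e}. cscale (c e) (T e))"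
      using leading[OF assms, of c] by simp
    then show "w \<in> \<delta> k ` level k" using sum_in_level by blast
  qed
  moreover have "cfun.dim (cfun.span (G ` {e \<in> J. fst e = k})) = card {e \<in> J. fst e = k}"
    using finite_J leading_indep by (intro dim_span_family) auto
  ultimately show ?thesis by simp
qed

text \<open>
  In a vanishing combination the leading coefficients vanish order by order, starting from the lowest.
\<close>

lemma dim_level:
  shows "cfun.dim (level k) = card {e \<in> J. k \<le> fst e}"
  unfolding level_def
proof (rule dim_span_family)
  fix c assume c: "(\<Sum>e\<in>{e \<in> J. k \<le> fst e}. cscale (c e) (T e)) = 0"
  have "(\<Sum>e\<in>{e \<in> J. m \<le> fst e}. cscale (c e) (T e)) = 0 \<and> (\<forall>e\<in>J. k \<le> fst e \<and> fst e < m \<longrightarrow> c e = 0)"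
    if "k \<le> m" for m
    using that
  proof (induction m rule: dec_induct)
    case base
    then show ?case using c by auto
  next
    case (step m)
    have *: "\<forall>e\<in>{e \<in> J. fst e = m}. c e = 0"
    proof (cases "m = 0")
      case True
      then show ?thesis using pos_J by fastforce
    next
      case False
      then have m: "1 \<le> m" by simp
      have "\<delta> m 0 = 0" using leading[OF m, of "\<lambda>_. 0"] by simp
      then have "(\<Sum>e\<in>{e \<in> J. fst e = m}. cscale (c e) (G e)) = 0"
        using step.IH leading[OF m, of c] by metis
      then show ?thesis
        by (rule leading_indep)
    qed
    then show ?case
      using step.IH split_level[of m c] by (auto simp: less_Suc_eq)
  qed
  note vanish = this
  show "\<forall>e\<in>{e \<in> J. k \<le> fst e}. c e = 0"
  proof
    fix e assume "e \<in> {e \<in> J. k \<le> fst e}"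
    then show "c e = 0" using vanish[of "Suc (fst e)"] by simp
  qed
qed (use finite_J in auto)

end

section \<open>Meromorphic germs with a cubic relation\<close>

text \<open>
  From \<open>f = (z - z\<^sub>0)\<^sup>m g\<close> with \<open>g(z\<^sub>0) \<noteq> 0\<close> one gets \<open>(z - z\<^sub>0) f'/f = m + (z - z\<^sub>0) g'/g\<close>.
\<close>

lemma log_derivative_tendsto:
  assumes f: "f meromorphic_on {z0}" and nz: "\<exists>\<^sub>F z in at z0. f z \<noteq> 0"
  obtains m where "((\<lambda>z. (z - z0) * deriv f z / f z) \<longlongrightarrow> m) (at z0)"
proof -
  define n g where "n = zorder f z0" and "g = zor_poly f z0"
  obtain r where r: "r > 0" "g z0 \<noteq> 0" "g holomorphic_on cball z0 r"
      "\<And>w. w \<in> cball z0 r - {z0} \<Longrightarrow> f w = g w * (w - z0) powi n \<and> g w \<noteq> 0"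
    using zorder_exist[of f z0] f nz unfolding meromorphic_at_iff n_def g_def by blast
  have hol: "g holomorphic_on ball z0 r"
    using r(3) by (rule holomorphic_on_subset) auto
  have ev: "eventually (\<lambda>z. z \<in> ball z0 r - {z0}) (at z0)"
    using r(1) by (intro eventually_at_in_open) auto
  have "isCont (deriv g) z0" "isCont g z0"
    using r(1) hol holomorphic_deriv[OF hol open_ball]
    by (auto intro!: continuous_on_interior[of "ball z0 r"] holomorphic_on_imp_continuous_on)
  then have "((\<lambda>z. (z - z0) * deriv g z / g z + of_int n) \<longlongrightarrow> (z0 - z0) * deriv g z0 / g z0 + of_int n) (at z0)"
    using r(2) by (intro tendsto_intros) (auto simp: isCont_def)
  moreover have "eventually (\<lambda>z. (z - z0) * deriv g z / g z + of_int n = (z - z0) * deriv f z / f z) (at z0)"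
    using ev
  proof eventually_elim
    case (elim z)
    have z: "z \<noteq> z0" "z \<in> ball z0 r" using elim by auto
    have g': "(g has_field_derivative deriv g z) (at z)"
      using hol z(2) by (simp add: holomorphic_derivI)
    have *: "((\<lambda>w. g w * (w - z0) powi n) has_field_derivative 
        deriv g z * (z - z0) powi n + g z * (of_int n * (z - z0) powi (n - 1))) (at z)"
      using g' z by (auto intro!: derivative_eq_intros)
    have "eventually (\<lambda>w. w \<in> ball z0 r - {z0}) (nhds z)"
      using z by (intro eventually_nhds_in_open) auto
    then have "eventually (\<lambda>w. g w * (w - z0) powi n = f w) (nhds z)"
      by eventually_elim (use r(4) in auto)
    then have "deriv f z = deriv g z * (z - z0) powi n + g z * (of_int n * (z - z0) powi (n - 1))"
      using DERIV_imp_deriv[OF *] deriv_cong_ev[of "\<lambda>w. g w * (w - z0) powi n" f z z] by simp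
    moreover have "f z = g z * (z - z0) powi n" "g z \<noteq> 0" using r(4)[of z] z by auto
    moreover have "(z - z0) powi n = (z - z0) powi (n - 1) * (z - z0)"
      using z power_int_add_1[of "z - z0" "n - 1"] by simp
    moreover have "(z - z0) powi (n - 1) \<noteq> 0" using z by simp
    moreover have "(z - z0) * (deriv g z * (b * (z - z0)) + g z * (of_int n * b)) / (g z * (b * (z - z0))) =
        (z - z0) * deriv g z / g z + of_int n" if "b \<noteq> 0" for b
      using that \<open>g z \<noteq> 0\<close> z by (simp add: field_simps)
    ultimately show ?case by simp
  qed
  ultimately have "((\<lambda>z. (z - z0) * deriv f z / f z) \<longlongrightarrow> (z0 - z0) * deriv g z0 / g z0 + of_int n) (at z0)"
    by (rule Lim_transform_eventually)
  then show ?thesis by (rule that)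
qed

text \<open>
  Riemann's theorem on removable singularities needs only \<open>(z - z\<^sub>0) f \<rightarrow> 0\<close>, which can be tested on cubes.
\<close>

lemma analytic_remove_sings_cube:
  assumes f: "f meromorphic_on {z0}" and lim: "((\<lambda>z. (z - z0) ^ 3 * f z ^ 3) \<longlongrightarrow> 0) (at z0)"
  shows "remove_sings f analytic_on {z0}"
proof -
  have iso: "isolated_singularity_at f z0" using f by (simp add: meromorphic_at_iff)
  obtain r where r: "r > 0" "f holomorphic_on ball z0 r - {z0}"
    using iso unfolding isolated_singularity_at_def using analytic_imp_holomorphic by blast
  have "((\<lambda>z. norm ((z - z0) ^ 3 * f z ^ 3)) \<longlongrightarrow> norm (0::complex)) (at z0)"
    using lim by (rule tendsto_norm)
  then have "((\<lambda>z. root 3 (norm ((z - z0) * f z) ^ 3)) \<longlongrightarrow> root 3 0) (at z0)"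
    by (intro tendsto_real_root) (simp add: norm_mult norm_power power_mult_distrib)
  moreover have "(\<lambda>z. root 3 (norm ((z - z0) * f z) ^ 3)) = (\<lambda>z. norm ((z - z0) * f z))"
    by (simp add: real_root_power_cancel)
  ultimately have "((\<lambda>z. norm ((z - z0) * f z)) \<longlongrightarrow> 0) (at z0)"
    by simp
  then have "((\<lambda>z. (z - z0) * f z) \<longlongrightarrow> 0) (at z0)"
    by (rule tendsto_norm_zero_cancel)
  then obtain g where g: "g holomorphic_on ball z0 r" "\<forall>z\<in>ball z0 r - {z0}. g z = f z"
    using holomorphic_on_extend_lim[OF r(2)] r(1) by auto
  have "g \<midarrow>z0\<rightarrow> g z0"
    using g(1) r(1) continuous_on_interior[of "ball z0 r" g z0] holomorphic_on_imp_continuous_on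
    by (auto simp: isCont_def)
  moreover have "eventually (\<lambda>z. g z = f z) (at z0)"
    using eventually_at_in_open[of "ball z0 r" z0] r(1) by (auto elim!: eventually_mono simp: g(2))
  ultimately have "f \<midarrow>z0\<rightarrow> g z0" by (rule Lim_transform_eventually)
  then show ?thesis using iso remove_sings_analytic_at by blast
qed

lemma tendsto_cube_over_poly:
  fixes D :: "complex poly"
  assumes "D \<noteq> 0" "order a D \<le> 2"
  shows "((\<lambda>u. (u - a) ^ 3 / poly D u) \<longlongrightarrow> 0) (at a)"
proof -
  obtain q where q: "D = [:- a, 1:] ^ order a D * q" "\<not> [:- a, 1:] dvd q"
    using order_decomp[OF assms(1), of a] by blast
  define m where "m = order a D"
  have qa: "poly q a \<noteq> 0" using q(2) by (simp add: poly_eq_0_iff_dvd)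
  have "((\<lambda>u. (u - a) ^ (3 - m) / poly q u) \<longlongrightarrow> (a - a) ^ (3 - m) / poly q a) (at a)"
    using qa by (intro tendsto_intros) auto
  then have "((\<lambda>u. (u - a) ^ (3 - m) / poly q u) \<longlongrightarrow> 0) (at a)"
    using assms(2) by (simp add: m_def power_0_left)
  moreover have "eventually (\<lambda>u. (u - a) ^ (3 - m) / poly q u = (u - a) ^ 3 / poly D u) (at a)"
    unfolding eventually_at_topological
  proof (intro exI[of _ UNIV] conjI ballI impI)
    fix u assume "u \<noteq> a"
    have "(u - a) ^ 3 = (u - a) ^ m * (u - a) ^ (3 - m)"
      using assms(2) by (simp add: m_def flip: power_add)
    moreover have "poly D u = (u - a) ^ m * poly q u"
      by (subst q(1)) (simp add: m_def)
    ultimately show "(u - a) ^ (3 - m) / poly q u = (u - a) ^ 3 / poly D u"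
      using \<open>u \<noteq> a\<close> by simp
  qed auto
  ultimately show ?thesis
    by (rule Lim_transform_eventually)
qed

text \<open>
  The cube of \<open>\<psi>\<close> is \<open>1/D(f)\<close>, so the criterion on cubes only involves \<open>f\<close>: the bounded logarithmic
  derivative of \<open>f - a\<close> leaves the factor \<open>(f - a)\<^sup>3 f\<^bsup>3j\<^esup>/D(f)\<close>. It tends to 0 when \<open>f \<rightarrow> a\<close>, as \<open>D\<close> vanishes
  at most doubly at \<open>a\<close>, and for \<open>a = 0\<close> also at a pole of \<open>f\<close>, by comparing degrees.
\<close>

lemma analytic_cyclic_differential:
  fixes D :: "complex poly"
  assumes x: "f meromorphic_on {z0}" and psi: "\<psi> meromorphic_on {z0}"
    and avoid: "\<And>a. eventually (\<lambda>z. f z \<noteq> a) (at z0)"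
    and eq: "eventually (\<lambda>z. \<psi> z ^ 3 * poly D (f z) = 1) (at z0)"
    and D: "D \<noteq> 0" "\<And>a. order a D \<le> 2"
    and cases: "f analytic_on {z0} \<or> is_pole f z0 \<and> 3 * j + 3 < degree D"
  shows "remove_sings (\<lambda>z. f z ^ j * \<psi> z * deriv f z) analytic_on {z0}"
proof (rule analytic_remove_sings_cube)
  show "(\<lambda>z. f z ^ j * \<psi> z * deriv f z) meromorphic_on {z0}"
    using x psi by (intro meromorphic_intros)
  have main: "((\<lambda>z. (z - z0) ^ 3 * (f z ^ j * \<psi> z * deriv f z) ^ 3) \<longlongrightarrow> 0) (at z0)"
    if lim: "((\<lambda>z. (f z - a) ^ 3 * f z ^ (3 * j) / poly D (f z)) \<longlongrightarrow> 0) (at z0)" for a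
  proof -
    have fa: "(\<lambda>z. f z - a) meromorphic_on {z0}" using x by (intro meromorphic_intros)
    have "\<exists>\<^sub>F z in at z0. f z - a \<noteq> 0"
      using avoid[of a] by (intro eventually_frequently) auto
    then obtain m where m: "((\<lambda>z. (z - z0) * deriv (\<lambda>z. f z - a) z / (f z - a)) \<longlongrightarrow> m) (at z0)"
      using log_derivative_tendsto[OF fa] by blast
    have "((\<lambda>z. ((z - z0) * deriv (\<lambda>z. f z - a) z / (f z - a)) ^ 3 * 
        ((f z - a) ^ 3 * f z ^ (3 * j) / poly D (f z))) \<longlongrightarrow> m ^ 3 * 0) (at z0)"
      by (intro tendsto_intros m lim)
    moreover have "eventually (\<lambda>z. f analytic_on {z}) (at z0)"
    proof -
      have "isolated_singularity_at f z0" using x by (simp add: meromorphic_at_iff)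
      then obtain r where r: "r > 0" "f analytic_on ball z0 r - {z0}"
        by (auto simp: isolated_singularity_at_def)
      then show ?thesis
        using eventually_at_in_open[of "ball z0 r" z0]
        by (auto elim!: eventually_mono intro: analytic_on_subset)
    qed
    then have "eventually (\<lambda>z. ((z - z0) * deriv (\<lambda>z. f z - a) z / (f z - a)) ^ 3 * 
        ((f z - a) ^ 3 * f z ^ (3 * j) / poly D (f z)) = 
        (z - z0) ^ 3 * (f z ^ j * \<psi> z * deriv f z) ^ 3) (at z0)"
      using avoid[of a] eq
    proof eventually_elim
      case (elim z)
      have d: "deriv (\<lambda>z. f z - a) z = deriv f z"
        using elim(1) by (simp add: deriv_diff analytic_on_imp_differentiable_at)
      have "poly D (f z) \<noteq> 0" using elim(3) by auto
      then have "\<psi> z ^ 3 = 1 / poly D (f z)" using elim(3) by (simp add: field_simps)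
      then have "(f z ^ j * \<psi> z * deriv f z) ^ 3 = f z ^ (3 * j) * deriv f z ^ 3 / poly D (f z)"
        by (simp add: power_mult_distrib power_mult mult.commute)
      then show ?case
        using elim(2) unfolding d by (simp add: power_mult_distrib power_divide)
    qed
    ultimately show ?thesis
      using Lim_transform_eventually by fastforce
  qed
  show "((\<lambda>z. (z - z0) ^ 3 * (f z ^ j * \<psi> z * deriv f z) ^ 3) \<longlongrightarrow> 0) (at z0)"
    using cases
  proof
    assume an: "f analytic_on {z0}"
    then have lim: "(f \<longlongrightarrow> f z0) (at z0)"
      using analytic_at_imp_isCont isCont_def by blast
    then have "filterlim f (at (f z0)) (at z0)"
      using avoid[of "f z0"] by (simp add: filterlim_at)
    then have "((\<lambda>z. (f z - f z0) ^ 3 / poly D (f z)) \<longlongrightarrow> 0) (at z0)"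
      using tendsto_cube_over_poly[OF D(1) D(2), of "f z0"] by (rule filterlim_compose[rotated])
    then have "((\<lambda>z. (f z - f z0) ^ 3 / poly D (f z) * f z ^ (3 * j)) \<longlongrightarrow> 0 * f z0 ^ (3 * j)) (at z0)"
      by (intro tendsto_intros lim)
    then show ?thesis
      by (intro main[of "f z0"]) (simp add: mult_ac)
  next
    assume pole: "is_pole f z0 \<and> 3 * j + 3 < degree D"
    have "((\<lambda>u. poly (monom 1 (3 * j + 3)) u / poly D u) \<longlongrightarrow> 0) at_infinity"
      using pole by (intro poly_divide_tendsto_0_at_infinity) (simp add: degree_monom_eq)
    then have "((\<lambda>z. poly (monom 1 (3 * j + 3)) (f z) / poly D (f z)) \<longlongrightarrow> 0) (at z0)"
      using pole unfolding is_pole_def by (auto intro: filterlim_compose)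
    then show ?thesis
      by (intro main[of 0]) (simp add: poly_monom power_add mult.commute)
  qed
qed

section \<open>Charts and nonconstant functions\<close>

locale riemann_surface =
  fixes X :: "'a topology" and \<A> :: "'a chart set"
  assumes surface: "compact_riemann_surface X \<A>"
begin

lemma chart:
  assumes "c \<in> \<A>"
  shows openin_cdom: "openin X (cdom c)" and open_cimg: "open (cimg c)"
    and homeomorphic_coord: "homeomorphic_map (subtopology X (cdom c)) (top_of_set (cimg c)) (coord c)"
proof -
  have "\<forall>c\<in>\<A>. openin X (cdom c) \<and> open (cimg c) \<and>
        homeomorphic_map (subtopology X (cdom c)) (top_of_set (cimg c)) (coord c)"
    using surface unfolding compact_riemann_surface_def by (elim conjE)
  then show "openin X (cdom c)" "open (cimg c)"
    "homeomorphic_map (subtopology X (cdom c)) (top_of_set (cimg c)) (coord c)"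
    using assms by simp_all
qed

lemma cdom_subset: "c \<in> \<A> \<Longrightarrow> cdom c \<subseteq> topspace X"
  by (rule openin_subset[OF openin_cdom])

lemma chart_exists:
  assumes "p \<in> topspace X"
  obtains c where "c \<in> \<A>" "p \<in> cdom c"
proof -
  have "(\<Union>c\<in>\<A>. cdom c) = topspace X"
    using surface unfolding compact_riemann_surface_def by (elim conjE)
  with assms have "p \<in> (\<Union>c\<in>\<A>. cdom c)" by simp
  then show ?thesis by (rule UN_E) (rule that)
qed

lemma inj_on_coord: "c \<in> \<A> \<Longrightarrow> inj_on (coord c) (cdom c)"
  using homeomorphic_imp_injective_map[OF homeomorphic_coord] cdom_subset by (simp add: Int_absorb1)

lemma coord_in_cimg: "p \<in> cdom c \<Longrightarrow> coord c p \<in> cimg c"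
  by (simp add: cimg_def)

lemma param_in_cdom: "z \<in> cimg c \<Longrightarrow> param c z \<in> cdom c"
  by (simp add: cimg_def param_def inv_into_into)

lemma coord_param: "z \<in> cimg c \<Longrightarrow> coord c (param c z) = z"
  by (simp add: cimg_def param_def f_inv_into_f)

lemma param_coord: "c \<in> \<A> \<Longrightarrow> p \<in> cdom c \<Longrightarrow> param c (coord c p) = p"
  using inj_on_coord by (simp add: param_def)

lemma open_coord_image:
  assumes "c \<in> \<A>" "openin X V"
  shows "open (coord c ` (cdom c \<inter> V))"
proof -
  have "openin (subtopology X (cdom c)) (cdom c \<inter> V)"
    by (rule openin_subtopology_Int2[OF assms(2)])
  then have "openin (top_of_set (cimg c)) (coord c ` (cdom c \<inter> V))"
    using homeomorphic_imp_open_map[OF homeomorphic_coord[OF assms(1)]] by (auto simp: open_map_def)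
  then show ?thesis
    using open_cimg[OF assms(1)] by (simp add: openin_open_eq)
qed

lemma openin_coord_preimage:
  assumes "c \<in> \<A>" "open S"
  shows "openin X {q \<in> cdom c. coord c q \<in> S}"
proof -
  have "openin (top_of_set (cimg c)) (cimg c \<inter> S)"
    using assms(2) by auto
  then have "openin (subtopology X (cdom c)) {q \<in> topspace (subtopology X (cdom c)). coord c q \<in> cimg c \<inter> S}"
    using homeomorphic_imp_continuous_map[OF homeomorphic_coord[OF assms(1)]] 
    by (rule openin_continuous_map_preimage[rotated])
  also have "{q \<in> topspace (subtopology X (cdom c)). coord c q \<in> cimg c \<inter> S} = {q \<in> cdom c. coord c q \<in> S}"
    using cdom_subset[OF assms(1)] by (auto simp: cimg_def)
  finally show ?thesis
    by (rule openin_trans_full[OF _ openin_cdom[OF assms(1)]])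
qed

definition transition :: "'a chart \<Rightarrow> 'a chart \<Rightarrow> complex \<Rightarrow> complex" where
  "transition c d = coord c \<circ> param d"

text \<open>
  The domain of the transition function from the coordinate of \<open>d\<close> to that of \<open>c\<close>.
\<close>

definition overlap :: "'a chart \<Rightarrow> 'a chart \<Rightarrow> complex set" where
  "overlap c d = coord d ` (cdom c \<inter> cdom d)"

lemma open_overlap:
  assumes "c \<in> \<A>" "d \<in> \<A>"
  shows "open (overlap c d)"
  unfolding overlap_def Int_commute[of "cdom c"]
  by (rule open_coord_image[OF assms(2) openin_cdom[OF assms(1)]])

lemma transition_holomorphic:
  assumes "c \<in> \<A>" "d \<in> \<A>"
  shows "transition c d holomorphic_on overlap c d"
proof -
  have "\<forall>c\<in>\<A>. \<forall>d\<in>\<A>. (coord c \<circ> param d) holomorphic_on (coord d ` (cdom c \<inter> cdom d))"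
    using surface unfolding compact_riemann_surface_def by (elim conjE)
  then show ?thesis
    unfolding transition_def overlap_def using assms by blast
qed

lemma in_overlapD:
  assumes "c \<in> \<A>" "d \<in> \<A>" "w \<in> overlap c d"
  shows "w \<in> cimg d" "param d w \<in> cdom c" "param d w \<in> cdom d" "transition c d w \<in> cimg c"
    "param c (transition c d w) = param d w"
proof -
  obtain p where p: "p \<in> cdom c" "p \<in> cdom d" "w = coord d p"
    using assms(3) unfolding overlap_def by blast
  then show "w \<in> cimg d" "param d w \<in> cdom c" "param d w \<in> cdom d" "transition c d w \<in> cimg c"
    "param c (transition c d w) = param d w"
    using assms(1,2) by (simp_all add: transition_def param_coord coord_in_cimg)
qed

lemma coord_in_overlap: "p \<in> cdom c \<Longrightarrow> p \<in> cdom d \<Longrightarrow> coord d p \<in> overlap c d"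
  by (auto simp: overlap_def)

lemma transition_coord: "d \<in> \<A> \<Longrightarrow> p \<in> cdom d \<Longrightarrow> transition c d (coord d p) = coord c p"
  by (simp add: transition_def param_coord)

lemma inj_on_transition:
  assumes "c \<in> \<A>" "d \<in> \<A>"
  shows "inj_on (transition c d) (overlap c d)"
proof (rule inj_onI)
  fix v w assume vw: "v \<in> overlap c d" "w \<in> overlap c d" and eq: "transition c d v = transition c d w"
  have "v = coord d (param c (transition c d v))" if "v \<in> overlap c d" for v
    using in_overlapD(1,5)[OF assms that] by (simp add: coord_param)
  from this[OF vw(1)] this[OF vw(2)] eq show "v = w" by metis
qed

lemma filterlim_transition:
  assumes "c \<in> \<A>" "d \<in> \<A>" "p \<in> cdom c" "p \<in> cdom d"
  shows "filterlim (transition c d) (at (coord c p)) (at (coord d p))"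
  unfolding filterlim_at
proof
  let ?w = "coord d p"
  have w: "?w \<in> overlap c d" using assms(3,4) by (rule coord_in_overlap)
  have "isCont (transition c d) ?w"
    using w continuous_on_eq_continuous_at[OF open_overlap[OF assms(1,2)], of "transition c d"]
      holomorphic_on_imp_continuous_on[OF transition_holomorphic[OF assms(1,2)]] by simp
  then show "(transition c d \<longlongrightarrow> coord c p) (at ?w)"
    using transition_coord[OF assms(2,4), of c] by (simp add: isCont_def)
  have "eventually (\<lambda>w. w \<in> overlap c d - {?w}) (at ?w)"
    by (rule eventually_at_in_open[OF open_overlap[OF assms(1,2)] w])
  then show "eventually (\<lambda>w. transition c d w \<in> UNIV \<and> transition c d w \<noteq> coord c p) (at ?w)"
  proof eventually_elim
    case (elim w)
    then show ?case
      using inj_on_eq_iff[OF inj_on_transition[OF assms(1,2)], of w ?w] w 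
        transition_coord[OF assms(2,4), of c] by simp
  qed
qed

lemma eventually_overlap:
  assumes "c \<in> \<A>" "d \<in> \<A>" "p \<in> cdom c" "p \<in> cdom d"
  shows "eventually (\<lambda>w. w \<in> overlap c d) (at (coord d p))"
  by (rule eventually_at_in_open'[OF open_overlap[OF assms(1,2)] coord_in_overlap[OF assms(3,4)]])

lemma eventually_change_chart:
  assumes "c \<in> \<A>" "d \<in> \<A>" "p \<in> cdom c" "p \<in> cdom d"
    and ev: "eventually (\<lambda>z. P (param c z)) (at (coord c p))"
  shows "eventually (\<lambda>w. P (param d w)) (at (coord d p))"
proof -
  have "eventually (\<lambda>w. P (param c (transition c d w))) (at (coord d p))"
    by (rule eventually_compose_filterlim[OF ev filterlim_transition[OF assms(1-4)]])
  then show ?thesis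
    using eventually_overlap[OF assms(1-4)]
    by eventually_elim (simp add: in_overlapD(5)[OF assms(1,2)])
qed

lemma openin_near:
  "openin X {p. \<exists>c\<in>\<A>. p \<in> cdom c \<and> eventually (\<lambda>z. P (param c z)) (at (coord c p))}" (is "openin X ?N")
proof (subst openin_subopen, intro ballI)
  fix p assume "p \<in> ?N"
  then obtain c where c: "c \<in> \<A>" "p \<in> cdom c" "eventually (\<lambda>z. P (param c z)) (at (coord c p))" by auto
  then obtain S where "open S" "coord c p \<in> S" "\<forall>z\<in>S. z \<noteq> coord c p \<longrightarrow> P (param c z)"
    unfolding eventually_at_topological by auto
  then have S: "open S" "coord c p \<in> S" "\<And>z. z \<in> S \<Longrightarrow> z \<noteq> coord c p \<Longrightarrow> P (param c z)"
    by simp_all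
  show "\<exists>V. openin X V \<and> p \<in> V \<and> V \<subseteq> ?N"
  proof (intro exI conjI subsetI)
    show "openin X {q \<in> cdom c. coord c q \<in> S}" using c(1) S(1) by (rule openin_coord_preimage)
    show "p \<in> {q \<in> cdom c. coord c q \<in> S}" using c S by simp
    fix q assume q: "q \<in> {q \<in> cdom c. coord c q \<in> S}"
    have "eventually (\<lambda>z. z \<in> S) (at (coord c q))"
      using q S(1) by (intro eventually_at_in_open') auto
    moreover have "eventually (\<lambda>z. z \<noteq> coord c p) (at (coord c q))"
      by (rule eventually_neq_at_within)
    ultimately have "eventually (\<lambda>z. P (param c z)) (at (coord c q))"
      by eventually_elim (rule S(3))
    then show "q \<in> ?N" using c(1) q by (intro CollectI bexI[of _ c] conjI) simp_all
  qed
qed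

text \<open>
  Transition functions are injective and continuous, so a pole seen in one chart is seen in every chart
  around the point.
\<close>

lemma poles_iff:
  assumes "c \<in> \<A>" "p \<in> cdom c"
  shows "p \<in> poles \<A> u \<longleftrightarrow> is_pole (u \<circ> param c) (coord c p)"
proof
  assume "p \<in> poles \<A> u"
  then obtain d where d: "d \<in> \<A>" "p \<in> cdom d" "is_pole (u \<circ> param d) (coord d p)"
    by (auto simp: poles_def)
  have "filterlim (\<lambda>w. (u \<circ> param d) (transition d c w)) at_infinity (at (coord c p))"
    using filterlim_compose[OF d(3)[unfolded is_pole_def] filterlim_transition[of d c p]] assms d by simp
  moreover have "eventually (\<lambda>w. (u \<circ> param d) (transition d c w) = (u \<circ> param c) w) (at (coord c p))"
    using eventually_overlap[OF d(1) assms(1) d(2) assms(2)]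
    by eventually_elim (simp add: in_overlapD(5)[OF d(1) assms(1)])
  ultimately show "is_pole (u \<circ> param c) (coord c p)"
    unfolding is_pole_def using filterlim_cong[of at_infinity at_infinity "at (coord c p)" "at (coord c p)"
      "\<lambda>w. (u \<circ> param d) (transition d c w)" "u \<circ> param c"] by simp
next
  assume "is_pole (u \<circ> param c) (coord c p)"
  with assms show "p \<in> poles \<A> u" unfolding poles_def by (intro CollectI bexI[of _ c] conjI)
qed

end

locale branched_cover = riemann_surface X \<A> for X :: "'a topology" and \<A> :: "'a chart set" +
  fixes x :: "'a \<Rightarrow> complex"
  assumes mero_x: "meromorphic_fun \<A> x"
    and nonconstant: "\<And>a. \<exists>p\<in>topspace X - poles \<A> x. x p \<noteq> a"
begin

lemma nicely_x: "c \<in> \<A> \<Longrightarrow> (x \<circ> param c) nicely_meromorphic_on cimg c"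
  using mero_x by (simp add: meromorphic_fun_def)

lemma meromorphic_x: "c \<in> \<A> \<Longrightarrow> (x \<circ> param c) meromorphic_on cimg c"
  using nicely_x nicely_meromorphic_on_def by blast

lemma analytic_x:
  assumes "c \<in> \<A>" "p \<in> cdom c" "p \<notin> poles \<A> x"
  shows "(x \<circ> param c) analytic_on {coord c p}"
  using nicely_meromorphic_on_imp_analytic_at[OF nicely_x[OF assms(1)] coord_in_cimg[OF assms(2)]]
    poles_iff[OF assms(1,2)] assms(3) by simp

text \<open>
  In a chart, a meromorphic function either equals \<open>a\<close> near a point or avoids \<open>a\<close> in a punctured
  neighbourhood. Both alternatives define open sets of points, so connectedness makes one of them hold
  everywhere, and a nonconstant function rules out the first.
\<close>

lemma eventually_avoids:
  assumes c: "c \<in> \<A>" "p \<in> cdom c"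
  shows "eventually (\<lambda>z. x (param c z) \<noteq> a) (at (coord c p))"
proof -
  \<comment> \<open>The points near which \<open>x\<close> equals \<open>a\<close>, respectively avoids \<open>a\<close>.\<close>
  define N where "N = {p. \<exists>c\<in>\<A>. p \<in> cdom c \<and> eventually (\<lambda>z. x (param c z) = a) (at (coord c p))}"
  define N' where "N' = {p. \<exists>c\<in>\<A>. p \<in> cdom c \<and> eventually (\<lambda>z. x (param c z) \<noteq> a) (at (coord c p))}"
  have N: "openin X N" "openin X N'"
    using openin_near[of "\<lambda>p. x p = a"] openin_near[of "\<lambda>p. x p \<noteq> a"] by (auto simp: N_def N'_def)
  have disj: "N \<inter> N' = {}"
  proof (safe, goal_cases)
    case (1 q)
    then obtain c d where "c \<in> \<A>" "q \<in> cdom c" "eventually (\<lambda>z. x (param c z) = a) (at (coord c q))"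
        and d: "d \<in> \<A>" "q \<in> cdom d" "eventually (\<lambda>z. x (param d z) \<noteq> a) (at (coord d q))"
      by (auto simp: N_def N'_def)
    then have "eventually (\<lambda>z. x (param d z) = a) (at (coord d q))"
      by (intro eventually_change_chart[of c d q "\<lambda>p. x p = a"])
    with d(3) have "eventually (\<lambda>z. False) (at (coord d q))"
      by eventually_elim auto
    then show ?case by simp
  qed
  have cover: "topspace X \<subseteq> N \<union> N'"
  proof
    fix q assume "q \<in> topspace X"
    then obtain c where c: "c \<in> \<A>" "q \<in> cdom c"
      by (rule chart_exists)
    have m: "(\<lambda>z. (x \<circ> param c) z - a) meromorphic_on {coord c q}"
      by (intro meromorphic_on_diff meromorphic_on_const meromorphic_on_subset[OF meromorphic_x[OF c(1)]])
        (simp add: coord_in_cimg c(2))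
    show "q \<in> N \<union> N'"
    proof (cases "\<exists>\<^sub>F z in at (coord c q). (x \<circ> param c) z - a \<noteq> 0")
      case True
      then have "eventually (\<lambda>z. (x \<circ> param c) z - a \<noteq> 0) (at (coord c q))"
        using non_zero_neighbour[of "\<lambda>z. (x \<circ> param c) z - a" "coord c q"] m by (simp only: meromorphic_at_iff)
      then show ?thesis using c by (auto simp: N'_def)
    next
      case False
      then show ?thesis using c by (auto simp: N_def frequently_def)
    qed
  qed
  obtain q where q: "q \<in> topspace X" "q \<notin> poles \<A> x" "x q \<noteq> a"
    using nonconstant by blast
  have "q \<notin> N"
  proof
    assume "q \<in> N"
    then obtain c where c: "c \<in> \<A>" "q \<in> cdom c" "eventually (\<lambda>z. x (param c z) = a) (at (coord c q))"
      by (auto simp: N_def)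
    have "((x \<circ> param c) \<longlongrightarrow> (x \<circ> param c) (coord c q)) (at (coord c q))"
      using analytic_at_imp_isCont[OF analytic_x[OF c(1,2) q(2)]] by (simp add: isCont_def)
    moreover have "((x \<circ> param c) \<longlongrightarrow> a) (at (coord c q))"
      using c(3) by (auto intro: tendsto_eventually)
    ultimately have "(x \<circ> param c) (coord c q) = a"
      by (rule tendsto_unique[OF trivial_limit_at])
    then show False using q c by (simp add: param_coord)
  qed
  have connected: "connected_space X"
    using surface unfolding compact_riemann_surface_def by (elim conjE)
  have "N' \<noteq> {}" using \<open>q \<notin> N\<close> cover q by auto
  then have "N = {}"
    using N disj cover connected unfolding connected_space_def by blast
  then have "p \<in> N'" using cover c cdom_subset by blast
  then obtain d where "d \<in> \<A>" "p \<in> cdom d" "eventually (\<lambda>z. x (param d z) \<noteq> a) (at (coord d p))"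
    by (auto simp: N'_def)
  then show ?thesis
    using eventually_change_chart[of d c p "\<lambda>p. x p \<noteq> a"] c by blast
qed

lemma eventually_analytic_x:
  assumes "c \<in> \<A>" "p \<in> cdom c"
  shows "eventually (\<lambda>z. z \<in> cimg c \<and> param c z \<notin> poles \<A> x) (at (coord c p))"
proof -
  have "(x \<circ> param c) meromorphic_on {coord c p}"
    using meromorphic_on_subset[OF meromorphic_x[OF assms(1)]] coord_in_cimg[OF assms(2)] by auto
  then have "eventually (\<lambda>z. \<not> is_pole (x \<circ> param c) z) (at (coord c p))"
    by (intro eventually_not_pole) (simp only: meromorphic_at_iff)
  moreover have "eventually (\<lambda>z. z \<in> cimg c) (at (coord c p))"
    by (rule eventually_at_in_open'[OF open_cimg[OF assms(1)] coord_in_cimg[OF assms(2)]])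
  ultimately show ?thesis
    by eventually_elim (simp add: poles_iff[OF assms(1) param_in_cdom] coord_param)
qed

end

section \<open>The differentials of a cyclic cover\<close>

lemma analytic_eq_at:
  assumes "f analytic_on {z0}" "g analytic_on {z0}" "eventually (\<lambda>z. f z = g z) (at z0)"
  shows "f z0 = (g z0 :: complex)"
proof -
  have "(f \<longlongrightarrow> f z0) (at z0)" "(g \<longlongrightarrow> g z0) (at z0)"
    using assms(1,2) analytic_at_imp_isCont by (auto simp: isCont_def)
  moreover from this(1) assms(3) have "(g \<longlongrightarrow> f z0) (at z0)"
    by (rule Lim_transform_eventually)
  ultimately show ?thesis
    using tendsto_unique[OF trivial_limit_at] by metis
qed

text \<open>
  The case distinction between the two spaces \<open>W\<^sub>1\<close> and \<open>W\<^sub>2\<close> disappears here: only the cubic relation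
  between \<open>\<psi>\<close> and \<open>x\<close> matters.
\<close>

locale cyclic_differentials = branched_cover X \<A> x
  for X :: "'a topology" and \<A> :: "'a chart set" and x :: "'a \<Rightarrow> complex" +
  fixes \<psi> :: "'a \<Rightarrow> complex" and D :: "complex poly" and n :: nat
  assumes meromorphic_psi: "\<And>c. c \<in> \<A> \<Longrightarrow> (\<psi> \<circ> param c) meromorphic_on cimg c"
    and cubic: "\<And>p. p \<in> topspace X - poles \<A> x \<Longrightarrow> poly D (x p) \<noteq> 0 \<Longrightarrow> \<psi> p ^ 3 * poly D (x p) = 1"
    and D_nonzero: "D \<noteq> 0" and order_D: "\<And>a. order a D \<le> 2"
    and degree_D: "n > 0 \<Longrightarrow> 3 * n + 3 < degree D"
begin

definition form :: "nat \<Rightarrow> 'a form" where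
  "form j = diff_form \<A> (\<lambda>p. x p ^ j * \<psi> p) x"

definition coeff_fun :: "'a chart \<Rightarrow> nat \<Rightarrow> complex \<Rightarrow> complex" where
  "coeff_fun c j = (\<lambda>z. (x \<circ> param c) z ^ j * (\<psi> \<circ> param c) z * deriv (x \<circ> param c) z)"

lemma form_eq: "c \<in> \<A> \<Longrightarrow> p \<in> cdom c \<Longrightarrow> form j (c, p) = remove_sings (coeff_fun c j) (coord c p)"
  by (simp add: form_def diff_form_def coeff_fun_def)

lemma form_outside: "\<not> (c \<in> \<A> \<and> p \<in> cdom c) \<Longrightarrow> form j (c, p) = 0"
  by (auto simp: form_def diff_form_def)

lemma eventually_cubic:
  assumes "c \<in> \<A>" "p \<in> cdom c"
  shows "eventually (\<lambda>z. \<psi> (param c z) ^ 3 * poly D (x (param c z)) = 1) (at (coord c p))"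
proof -
  have "eventually (\<lambda>z. \<forall>a\<in>{a. poly D a = 0}. x (param c z) \<noteq> a) (at (coord c p))"
    using eventually_avoids[OF assms] poly_roots_finite[OF D_nonzero] by (intro eventually_ball_finite) auto
  then show ?thesis
    using eventually_analytic_x[OF assms]
    by eventually_elim (use cubic param_in_cdom cdom_subset[OF assms(1)] in blast)
qed

lemma meromorphic_coeff:
  assumes "c \<in> \<A>"
  shows "coeff_fun c j meromorphic_on cimg c"
  unfolding coeff_fun_def
  by (intro meromorphic_on_mult meromorphic_on_power meromorphic_on_deriv meromorphic_x[OF assms]
      meromorphic_psi[OF assms])

lemma meromorphic_at_coord:
  assumes "f meromorphic_on cimg c" "p \<in> cdom c"
  shows "f meromorphic_on {coord c p}"
  using assms(1) by (rule meromorphic_on_subset) (simp add: coord_in_cimg assms(2))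

lemma eventually_coeff:
  assumes "c \<in> \<A>" "p \<in> cdom c"
  shows "eventually (\<lambda>z. remove_sings (coeff_fun c j) z = coeff_fun c j z) (at (coord c p))"
  using meromorphic_at_coord[OF meromorphic_coeff[OF assms(1)] assms(2)]
  by (intro eventually_remove_sings_eq_at) (simp add: meromorphic_at_iff)

lemma analytic_form:
  assumes c: "c \<in> \<A>" "p \<in> cdom c" and j: "p \<notin> poles \<A> x \<or> 3 * j + 3 < degree D"
  shows "remove_sings (coeff_fun c j) analytic_on {coord c p}"
  unfolding coeff_fun_def
proof (rule analytic_cyclic_differential)
  show "(x \<circ> param c) meromorphic_on {coord c p}" "(\<psi> \<circ> param c) meromorphic_on {coord c p}"
    by (intro meromorphic_at_coord meromorphic_x meromorphic_psi c)+
  show "eventually (\<lambda>z. (x \<circ> param c) z \<noteq> a) (at (coord c p))" for a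
    using eventually_avoids[OF c] by simp
  show "eventually (\<lambda>z. (\<psi> \<circ> param c) z ^ 3 * poly D ((x \<circ> param c) z) = 1) (at (coord c p))"
    using eventually_cubic[OF c] by simp
  show "(x \<circ> param c) analytic_on {coord c p} \<or> is_pole (x \<circ> param c) (coord c p) \<and> 3 * j + 3 < degree D"
    using j analytic_x[OF c] poles_iff[OF c] by blast
qed (fact D_nonzero order_D)+

lemma degree_bound: "1 \<le> j \<Longrightarrow> j \<le> n \<Longrightarrow> 3 * j + 3 < degree D"
  using degree_D by auto

lemma form_power:
  assumes c: "c \<in> \<A>" "p \<in> cdom c" "p \<notin> poles \<A> x"
  shows "form (i + j) (c, p) = x p ^ i * form j (c, p)"
proof -
  have "remove_sings (coeff_fun c (i + j)) (coord c p) = 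
      (x \<circ> param c) (coord c p) ^ i * remove_sings (coeff_fun c j) (coord c p)"
  proof (rule analytic_eq_at[where g = "\<lambda>z. (x \<circ> param c) z ^ i * remove_sings (coeff_fun c j) z"])
    show "(\<lambda>z. (x \<circ> param c) z ^ i * remove_sings (coeff_fun c j) z) analytic_on {coord c p}"
      using c by (intro analytic_on_mult analytic_on_power analytic_x analytic_form) auto
    show "eventually (\<lambda>z. remove_sings (coeff_fun c (i + j)) z = 
        (x \<circ> param c) z ^ i * remove_sings (coeff_fun c j) z) (at (coord c p))"
      using eventually_coeff[OF c(1,2), of "i + j"] eventually_coeff[OF c(1,2), of j]
      by eventually_elim (simp add: coeff_fun_def power_add)
  qed (use c in \<open>auto intro: analytic_form\<close>)
  then show ?thesis using c by (simp add: form_eq param_coord)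
qed

lemma analytic_inverse_x:
  assumes "c \<in> \<A>" "p \<in> cdom c" "p \<in> poles \<A> x"
  shows "(\<lambda>z. inverse (x (param c z))) analytic_on {coord c p}"
proof -
  have "((\<lambda>z. inverse ((x \<circ> param c) z)) \<longlongrightarrow> 0) (at (coord c p))"
    using assms(3) unfolding poles_iff[OF assms(1,2)] is_pole_def
    by (rule filterlim_compose[OF tendsto_inverse_0])
  then have "\<not> is_pole (\<lambda>z. inverse ((x \<circ> param c) z)) (coord c p)"
    unfolding is_pole_def using not_tendsto_and_filterlim_at_infinity[OF trivial_limit_at] by blast
  then show ?thesis
    using nicely_meromorphic_on_imp_analytic_at[OF nicely_meromorphic_on_inverse[OF nicely_x[OF assms(1)]]
       coord_in_cimg[OF assms(2)]] by simp
qed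

text \<open>
  Near a pole of \<open>x\<close> the form \<open>\<omega>\<^sub>n\<close> and the function \<open>1/x\<close> replace \<open>\<omega>\<^sub>0\<close> and \<open>x\<close>. At the pole itself
  the formula uses that both \<open>x\<close> and \<open>inverse 0\<close> are 0, the true value of \<open>1/x\<close>.
\<close>

lemma form_inverse_power:
  assumes c: "c \<in> \<A>" "p \<in> cdom c" "p \<in> poles \<A> x \<or> x p \<noteq> 0" and j: "1 \<le> j" "j \<le> n"
  shows "form j (c, p) = inverse (x p) ^ (n - j) * form n (c, p)"
proof (cases "p \<in> poles \<A> x")
  case False
  then have "form n (c, p) = x p ^ (n - j) * form j (c, p)" "x p \<noteq> 0"
    using form_power[OF c(1,2) False, of "n - j" j] j c(3) by auto
  then show ?thesis by (simp add: field_simps)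
next
  case True
  have "remove_sings (coeff_fun c j) (coord c p) = 
      inverse (x (param c (coord c p))) ^ (n - j) * remove_sings (coeff_fun c n) (coord c p)"
  proof (rule analytic_eq_at[where g = "\<lambda>z. inverse (x (param c z)) ^ (n - j) * remove_sings (coeff_fun c n) z"])
    show "(\<lambda>z. inverse (x (param c z)) ^ (n - j) * remove_sings (coeff_fun c n) z) analytic_on {coord c p}"
      using c True j degree_bound by (intro analytic_on_mult analytic_on_power analytic_inverse_x analytic_form) auto
    show "remove_sings (coeff_fun c j) analytic_on {coord c p}"
      using c j degree_bound by (intro analytic_form) auto
    show "eventually (\<lambda>z. remove_sings (coeff_fun c j) z = 
        inverse (x (param c z)) ^ (n - j) * remove_sings (coeff_fun c n) z) (at (coord c p))"
      using eventually_coeff[OF c(1,2), of j] eventually_coeff[OF c(1,2), of n] eventually_avoids[OF c(1,2), of 0]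
    proof eventually_elim
      case (elim z)
      have "x (param c z) ^ n = x (param c z) ^ (n - j) * x (param c z) ^ j"
        using j by (simp flip: power_add)
      then show ?case using elim by (simp add: coeff_fun_def field_simps)
    qed
  qed
  then show ?thesis using c by (simp add: form_eq param_coord)
qed

lemma form_param: "c \<in> \<A> \<Longrightarrow> z \<in> cimg c \<Longrightarrow> form j (c, param c z) = remove_sings (coeff_fun c j) z"
  by (simp add: form_eq param_in_cdom coord_param)

text \<open>
  Outside the singularities of the coefficients this is the chain rule; both sides extend analytically to
  the remaining points.
\<close>

lemma form_change_chart:
  assumes c: "c \<in> \<A>" "p \<in> cdom c" and d: "d \<in> \<A>" "p \<in> cdom d" and j: "1 \<le> j" "j \<le> n"
  shows "form j (d, p) = form j (c, p) * deriv (coord c \<circ> param d) (coord d p)"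
proof -
  define \<tau> where "\<tau> = transition c d"
  have tau: "\<tau> holomorphic_on overlap c d" "open (overlap c d)" "coord d p \<in> overlap c d"
    using transition_holomorphic open_overlap coord_in_overlap c d by (auto simp: \<tau>_def)
  have an: "\<tau> analytic_on {coord d p}" "deriv \<tau> analytic_on {coord d p}"
    using tau analytic_at holomorphic_deriv by blast+
  have "remove_sings (coeff_fun d j) (coord d p) = 
      remove_sings (coeff_fun c j) (\<tau> (coord d p)) * deriv \<tau> (coord d p)"
  proof (rule analytic_eq_at[where g = "\<lambda>w. remove_sings (coeff_fun c j) (\<tau> w) * deriv \<tau> w"])
    show "remove_sings (coeff_fun d j) analytic_on {coord d p}"
      using d j degree_bound by (intro analytic_form) auto
    have "remove_sings (coeff_fun c j) analytic_on \<tau> ` {coord d p}"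
      using c d j degree_bound by (simp add: \<tau>_def transition_coord analytic_form)
    then have "(remove_sings (coeff_fun c j) \<circ> \<tau>) analytic_on {coord d p}"
      by (rule analytic_on_compose[OF an(1)])
    then show "(\<lambda>w. remove_sings (coeff_fun c j) (\<tau> w) * deriv \<tau> w) analytic_on {coord d p}"
      using an(2) by (intro analytic_on_mult) (simp_all add: o_def)
    have lim: "filterlim \<tau> (at (coord c p)) (at (coord d p))"
      unfolding \<tau>_def using c d by (intro filterlim_transition)
    show "eventually (\<lambda>w. remove_sings (coeff_fun d j) w = 
        remove_sings (coeff_fun c j) (\<tau> w) * deriv \<tau> w) (at (coord d p))"
      using eventually_coeff[OF d, of j] eventually_overlap[OF c(1) d(1) c(2) d(2)]
        eventually_compose_filterlim[OF eventually_coeff[OF c, of j] lim]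
        eventually_compose_filterlim[OF eventually_analytic_x[OF c] lim]
    proof eventually_elim
      case (elim w)
      have pw: "param c (\<tau> w) = param d w"
        unfolding \<tau>_def by (rule in_overlapD(5)[OF c(1) d(1) elim(2)])
      have "eventually (\<lambda>w. w \<in> overlap c d) (nhds w)"
        using elim(2) tau(2) by (rule eventually_nhds_in_open[rotated])
      then have "eventually (\<lambda>w. (x \<circ> param d) w = (x \<circ> param c \<circ> \<tau>) w) (nhds w)"
        by eventually_elim (simp add: \<tau>_def in_overlapD(5)[OF c(1) d(1)])
      then have "deriv (x \<circ> param d) w = deriv (x \<circ> param c \<circ> \<tau>) w"
        by (intro deriv_cong_ev refl)
      also have "\<dots> = deriv (x \<circ> param c) (\<tau> w) * deriv \<tau> w"
      proof (rule deriv_chain)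
        show "\<tau> field_differentiable at w"
          using tau elim(2) by (intro holomorphic_on_imp_differentiable_at)
        have "(x \<circ> param c) analytic_on {coord c (param c (\<tau> w))}"
          using elim(4) c(1) by (intro analytic_x param_in_cdom) auto
        then show "(x \<circ> param c) field_differentiable at (\<tau> w)"
          using elim(4) by (intro analytic_on_imp_differentiable_at[of _ "{\<tau> w}"]) (simp_all add: coord_param)
      qed
      finally show ?case
        using elim(1,3) by (simp add: coeff_fun_def pw)
    qed
  qed
  then show ?thesis using c d by (simp add: form_eq \<tau>_def transition_coord) (simp add: transition_def)
qed

lemma form_holomorphic:
  assumes j: "1 \<le> j" "j \<le> n"
  shows "form j \<in> holomorphic_forms \<A>"
  unfolding holomorphic_forms_def
proof (intro CollectI conjI ballI allI impI)
  fix c assume c: "c \<in> \<A>"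
  have "remove_sings (coeff_fun c j) analytic_on {z}" if "z \<in> cimg c" for z
    using analytic_form[OF c param_in_cdom[OF that], of j] degree_bound[OF j] by (simp add: coord_param that)
  then have "remove_sings (coeff_fun c j) holomorphic_on cimg c"
    by (intro analytic_imp_holomorphic) (simp add: analytic_on_analytic_at[of _ "cimg c"])
  then show "(\<lambda>z. form j (c, param c z)) holomorphic_on cimg c"
    by (rule holomorphic_transform) (simp add: form_param c)
next
  fix c p assume "\<not> (c \<in> \<A> \<and> p \<in> cdom c)"
  then show "form j (c, p) = 0" by (rule form_outside)
next
  fix c d p assume "c \<in> \<A>" "d \<in> \<A>" "p \<in> cdom c \<inter> cdom d"
  then show "form j (d, p) = form j (c, p) * deriv (coord c \<circ> param d) (coord d p)"
    by (intro form_change_chart j) simp_all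
qed

text \<open>
  The quotient \<open>\<omega>\<^sub>j/x\<close> is \<open>\<omega>\<^bsub>j-1\<^esub>\<close>, which is holomorphic away from the poles of \<open>x\<close> even for \<open>j = 1\<close>.
\<close>

lemma form_in_H0_M:
  assumes j: "1 \<le> j" "j \<le> n"
  shows "form j \<in> H0_M \<A> x"
  unfolding H0_M_def
proof (intro CollectI conjI ballI)
  show "form j \<in> holomorphic_forms \<A>" by (rule form_holomorphic[OF j])
  fix c assume c: "c \<in> \<A>"
  let ?h = "remove_sings (coeff_fun c (j - 1))"
  show "\<exists>h. h holomorphic_on coord c ` (cdom c - poles \<A> x) \<and> 
      (\<forall>p\<in>cdom c - poles \<A> x. form j (c, p) = x p * h (coord c p))"
  proof (intro exI[of _ ?h] conjI ballI)
    have "?h analytic_on coord c ` (cdom c - poles \<A> x)"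
      by (subst analytic_on_analytic_at) (auto intro!: analytic_form c)
    then show "?h holomorphic_on coord c ` (cdom c - poles \<A> x)"
      by (rule analytic_imp_holomorphic)
    show "form j (c, p) = x p * ?h (coord c p)" if "p \<in> cdom c - poles \<A> x" for p
      using form_power[of c p 1 "j - 1"] that c j by (simp add: form_eq)
  qed
qed

end

section \<open>Restriction to the diagonal\<close>

context cyclic_differentials
begin

definition tensor :: "nat \<Rightarrow> nat \<Rightarrow> 'a biform" where
  "tensor i j = (\<lambda>(a, b). form i a * form j b)"

lemma diag_mult_finite:
  assumes "c \<in> \<A>" "p \<in> cdom c" "p \<notin> poles \<A> x" "q \<in> cdom c" "q \<notin> poles \<A> x"
  shows "diag_mult l tensor i j ((c, p), (c, q)) =
     (x p - x q) ^ l * (x p ^ i * x q ^ j) * (form 0 (c, p) * form 0 (c, q))"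
proof (induction l arbitrary: i j)
  case 0
  show ?case
    using form_power[OF assms(1,2,3), of i 0] form_power[OF assms(1,4,5), of j 0]
    by (simp add: tensor_def)
next
  case (Suc l)
  show ?case by (simp add: Suc.IH algebra_simps)
qed

text \<open>
  The formula in terms of \<open>1/x\<close>, obtained from \<open>u - v = u v (1/v - 1/u)\<close>. It remains valid at the
  poles, which is why the exponents must not exceed \<open>n\<close>.
\<close>

lemma diag_mult_infinite:
  assumes p: "c \<in> \<A>" "p \<in> cdom c" "p \<in> poles \<A> x \<or> x p \<noteq> 0"
    and q: "q \<in> cdom c" "q \<in> poles \<A> x \<or> x q \<noteq> 0"
    and "1 \<le> i" "1 \<le> j" "i + l \<le> n" "j + l \<le> n"
  shows "diag_mult l tensor i j ((c, p), (c, q)) =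
     (inverse (x q) - inverse (x p)) ^ l * (inverse (x p) ^ (n - l - i) * inverse (x q) ^ (n - l - j))
       * (form n (c, p) * form n (c, q))"
  using assms(6-)
proof (induction l arbitrary: i j)
  case 0
  then show ?case
    using form_inverse_power[OF p, of i] form_inverse_power[OF p(1) q, of j]
    by (simp add: tensor_def)
next
  case (Suc l)
  define u v where "u = inverse (x p)" and "v = inverse (x q)"
  obtain a b where ab: "n = a + Suc l + i" "n = b + Suc l + j"
    using Suc.prems(3,4) by (metis le_add_diff_inverse2 add.commute add.assoc)
  have e: "n - Suc l - i = a" "n - Suc l - j = b" "n - l - Suc i = a" "n - l - j = Suc b"
      "n - l - i = Suc a" "n - l - Suc j = b"
    using ab by arith+
  have 1: "diag_mult l tensor (Suc i) j ((c, p), (c, q)) = 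
      (v - u) ^ l * (u ^ a * v ^ Suc b) * (form n (c, p) * form n (c, q))"
    using Suc.IH[of "Suc i" j] Suc.prems unfolding e u_def v_def by simp
  have 2: "diag_mult l tensor i (Suc j) ((c, p), (c, q)) = 
      (v - u) ^ l * (u ^ Suc a * v ^ b) * (form n (c, p) * form n (c, q))"
    using Suc.IH[of i "Suc j"] Suc.prems unfolding e u_def v_def by simp
  show ?case
    unfolding e(1,2) u_def[symmetric] v_def[symmetric] by (simp add: 1 2 algebra_simps)
qed

lemma difference_power_tendsto:
  assumes "\<phi> analytic_on {z0}"
  shows "((\<lambda>w. ((\<phi> z0 - \<phi> w) / (z0 - w)) ^ l) \<longlongrightarrow> deriv \<phi> z0 ^ l) (at z0)"
proof -
  have "(\<phi> has_field_derivative deriv \<phi> z0) (at z0)"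
    using assms analytic_on_imp_differentiable_at by (auto simp: field_differentiable_derivI)
  then have "((\<lambda>w. (\<phi> w - \<phi> z0) / (w - z0)) \<longlongrightarrow> deriv \<phi> z0) (at z0)"
    by (simp add: has_field_derivative_iff)
  moreover have "(\<lambda>w. (\<phi> w - \<phi> z0) / (w - z0)) = (\<lambda>w. (\<phi> z0 - \<phi> w) / (z0 - w))"
    by (rule ext) (subst minus_divide_divide[symmetric], simp)
  ultimately show ?thesis by (intro tendsto_power) simp
qed

lemma tendsto_analytic: "f analytic_on {z0} \<Longrightarrow> (f \<longlongrightarrow> f z0) (at z0)" for f :: "complex \<Rightarrow> complex"
  using analytic_at_imp_isCont by (simp add: isCont_def)

lemma eventually_form:
  assumes "c \<in> \<A>" "p \<in> cdom c"
  shows "eventually (\<lambda>z. form j (c, param c z) = remove_sings (coeff_fun c j) z) (at (coord c p))"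
  using eventually_analytic_x[OF assms] by eventually_elim (simp add: form_param assms(1))

text \<open>
  By the product formula, division by \<open>(z\<^sub>0 - w)\<^sup>l\<close> turns the factor \<open>(x(p) - x(q))\<^sup>l\<close> into the \<open>l\<close>-th
  power of a difference quotient of \<open>x\<close>. The limit exists at every point outside the poles,
  ramification points included.
\<close>

lemma gauss_quotient_finite:
  assumes c: "c \<in> \<A>" "p \<in> cdom c" "p \<notin> poles \<A> x"
  shows "((\<lambda>w. sym_mult l tensor a b ((c, p), (c, param c w)) / (coord c p - w) ^ l) \<longlongrightarrow>
     2 * x p ^ (a + b) * deriv (x \<circ> param c) (coord c p) ^ l * form 0 (c, p) ^ 2) (at (coord c p))"
proof -
  let ?z = "coord c p" and ?f = "x \<circ> param c" and ?h = "remove_sings (coeff_fun c 0)"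
  have f: "?f analytic_on {?z}" using c by (rule analytic_x)
  have h: "?h analytic_on {?z}" using c by (intro analytic_form) auto
  have "((\<lambda>w. ((?f ?z - ?f w) / (?z - w)) ^ l * ((?f ?z ^ a * ?f w ^ b + ?f ?z ^ b * ?f w ^ a) * (?h ?z * ?h w)))
     \<longlongrightarrow> deriv ?f ?z ^ l * ((?f ?z ^ a * ?f ?z ^ b + ?f ?z ^ b * ?f ?z ^ a) * (?h ?z * ?h ?z))) (at ?z)"
    by (intro tendsto_mult tendsto_add tendsto_power tendsto_const difference_power_tendsto[OF f]
        tendsto_analytic[OF f] tendsto_analytic[OF h])
  moreover have "eventually (\<lambda>w. ((?f ?z - ?f w) / (?z - w)) ^ l * ((?f ?z ^ a * ?f w ^ b + ?f ?z ^ b * ?f w ^ a) * (?h ?z * ?h w))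
     = sym_mult l tensor a b ((c, p), (c, param c w)) / (?z - w) ^ l) (at ?z)"
    using eventually_analytic_x[OF c(1,2)]
  proof eventually_elim
    case (elim w)
    then show ?case
      using c by (simp add: sym_mult_def diag_mult_finite[OF c param_in_cdom] form_param form_eq param_coord
          power_divide algebra_simps add_divide_distrib)
  qed
  ultimately have "((\<lambda>w. sym_mult l tensor a b ((c, p), (c, param c w)) / (?z - w) ^ l) \<longlongrightarrow>
      deriv ?f ?z ^ l * ((?f ?z ^ a * ?f ?z ^ b + ?f ?z ^ b * ?f ?z ^ a) * (?h ?z * ?h ?z))) (at ?z)"
    by (rule Lim_transform_eventually)
  then show ?thesis
    using c by (simp add: form_eq param_coord power_add power2_eq_square mult_ac)
qed

text \<open>
  The same argument with the coordinate \<open>1/x\<close>. Relations between leading terms are detected away from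
  the poles, so the value of this limit is left unspecified.
\<close>

lemma gauss_quotient_infinite:
  assumes c: "c \<in> \<A>" "p \<in> cdom c" "p \<in> poles \<A> x" 
    and ab: "1 \<le> a" "1 \<le> b" "a + l \<le> n" "b + l \<le> n"
  shows "\<exists>L. ((\<lambda>w. sym_mult l tensor a b ((c, p), (c, param c w)) / (coord c p - w) ^ l) \<longlongrightarrow> L) (at (coord c p))"
proof -
  let ?z = "coord c p" and ?h = "remove_sings (coeff_fun c n)"
  define f where "f = (\<lambda>z. inverse (x (param c z)))"
  define A B where "A = n - l - a" and "B = n - l - b"
  have f: "f analytic_on {?z}" unfolding f_def using c by (rule analytic_inverse_x)
  have h: "?h analytic_on {?z}" using c ab degree_bound[of n] by (intro analytic_form) auto
  have "((\<lambda>w. (-1) ^ l * ((f ?z - f w) / (?z - w)) ^ l * ((f ?z ^ A * f w ^ B + f ?z ^ B * f w ^ A) * (?h ?z * ?h w)))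
     \<longlongrightarrow> (-1) ^ l * deriv f ?z ^ l * ((f ?z ^ A * f ?z ^ B + f ?z ^ B * f ?z ^ A) * (?h ?z * ?h ?z))) (at ?z)"
    by (intro tendsto_mult tendsto_add tendsto_power tendsto_const difference_power_tendsto[OF f]
        tendsto_analytic[OF f] tendsto_analytic[OF h])
  moreover have "eventually (\<lambda>w. (-1) ^ l * ((f ?z - f w) / (?z - w)) ^ l * 
      ((f ?z ^ A * f w ^ B + f ?z ^ B * f w ^ A) * (?h ?z * ?h w))
     = sym_mult l tensor a b ((c, p), (c, param c w)) / (?z - w) ^ l) (at ?z)"
    using eventually_analytic_x[OF c(1,2)] eventually_avoids[OF c(1,2), of 0]
  proof eventually_elim
    case (elim w)
    have fz: "inverse (x p) = f ?z" using c by (simp add: f_def param_coord)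
    have fw: "inverse (x (param c w)) = f w" by (simp add: f_def)
    have "sym_mult l tensor a b ((c, p), (c, param c w)) = 
        (f w - f ?z) ^ l * (f ?z ^ A * f w ^ B + f ?z ^ B * f w ^ A) * (form n (c, p) * form n (c, param c w))"
    proof -
      have q: "param c w \<in> cdom c" using elim by (simp add: param_in_cdom)
      have 1: "diag_mult l tensor a b ((c, p), (c, param c w)) = 
          (f w - f ?z) ^ l * (f ?z ^ A * f w ^ B) * (form n (c, p) * form n (c, param c w))"
        using diag_mult_infinite[OF c(1,2) disjI1[OF c(3)] q disjI2[OF elim(2)] ab]
        unfolding fz fw A_def B_def .
      have 2: "diag_mult l tensor b a ((c, p), (c, param c w)) = 
          (f w - f ?z) ^ l * (f ?z ^ B * f w ^ A) * (form n (c, p) * form n (c, param c w))"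
        using diag_mult_infinite[OF c(1,2) disjI1[OF c(3)] q disjI2[OF elim(2)] ab(2,1,4,3)]
        unfolding fz fw A_def B_def .
      show ?thesis
        unfolding sym_mult_def plus_fun_apply 1 2 by (simp only: distrib_left distrib_right)
    qed
    moreover have "(f w - f ?z) ^ l = (-1) ^ l * (f ?z - f w) ^ l"
      by (simp flip: power_mult_distrib)
    ultimately show ?case
      using elim c by (simp add: form_param form_eq power_divide)
  qed
  ultimately show ?thesis
    by (intro exI) (rule Lim_transform_eventually)
qed

lemma gauss_quotient_tendsto:
  assumes c: "c \<in> \<A>" "p \<in> cdom c" and e: "e \<in> gauss_index n k"
  shows "\<exists>L. ((\<lambda>w. gauss_basis tensor e ((c, p), (c, param c w)) / (coord c p - w) ^ (2 * fst e - 1)) \<longlongrightarrow> L)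
     (at (coord c p))"
proof (cases "p \<in> poles \<A> x")
  case False
  then show ?thesis
    using gauss_quotient_finite[OF c False] by (auto simp: gauss_basis_def split: prod.splits)
next
  case True
  show ?thesis
    using gauss_quotient_infinite[OF c True, of "1 + (snd e + 1) div 2" "1 + snd e div 2" "2 * fst e - 1"] e
    by (auto simp: gauss_basis_def gauss_index_def split: prod.splits)
qed

text \<open>
  The leading term along the diagonal of a basis tensor.
\<close>

definition symbol :: "nat \<times> nat \<Rightarrow> 'a form" where
  "symbol e = diag_restrict \<A> (2 * fst e - 1) (gauss_basis tensor e)"

lemma symbol_tendsto:
  assumes c: "c \<in> \<A>" "p \<in> cdom c" and e: "e \<in> gauss_index n k"
  shows "((\<lambda>w. gauss_basis tensor e ((c, p), (c, param c w)) / (coord c p - w) ^ (2 * fst e - 1)) \<longlongrightarrow> symbol e (c, p))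
     (at (coord c p))"
proof -
  obtain L where L: "((\<lambda>w. gauss_basis tensor e ((c, p), (c, param c w)) / (coord c p - w) ^ (2 * fst e - 1)) \<longlongrightarrow> L)
     (at (coord c p))"
    using gauss_quotient_tendsto[OF assms] by blast
  then have "symbol e (c, p) = L"
    using c tendsto_Lim[OF trivial_limit_at L] by (simp add: symbol_def diag_restrict_def)
  then show ?thesis using L by simp
qed

lemma symbol_finite:
  assumes c: "c \<in> \<A>" "p \<in> cdom c" "p \<notin> poles \<A> x" and e: "(k, d) \<in> gauss_index n k"
  shows "symbol (k, d) (c, p) = 
     2 * x p ^ (d + 2) * deriv (x \<circ> param c) (coord c p) ^ (2 * k - 1) * form 0 (c, p) ^ 2"
proof -
  have "1 + (d + 1) div 2 + (1 + d div 2) = d + 2" by presburger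
  then show ?thesis
    using tendsto_unique[OF trivial_limit_at symbol_tendsto[OF c(1,2) e]]
      gauss_quotient_finite[OF c, of "2 * k - 1" "1 + (d + 1) div 2" "1 + d div 2"]
    by (simp add: gauss_basis_def)
qed

lemma symbol_outside: "\<not> (c \<in> \<A> \<and> p \<in> cdom c) \<Longrightarrow> symbol e (c, p) = 0"
  by (auto simp: symbol_def diag_restrict_def)

lemma sum_cscale_apply: "(\<Sum>e\<in>J. cscale (c e) (T e)) a = (\<Sum>e\<in>J. c e * T e a)"
  by (induction J rule: infinite_finite_induct) (auto simp: cscale_def)

text \<open>
  After division by \<open>(z\<^sub>0 - w)\<^bsup>2k-1\<^esup>\<close> the tensors of higher order tend to 0, and those of order
  \<open>2k - 1\<close> tend to their leading terms.
\<close>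

lemma diag_restrict_sum:
  assumes k: "1 \<le> k"
  shows "diag_restrict \<A> (2 * k - 1) (\<Sum>e\<in>gauss_index n k. cscale (g e) (gauss_basis tensor e)) =
     (\<Sum>e\<in>{e \<in> gauss_index n k. fst e = k}. cscale (g e) (symbol e))" (is "diag_restrict _ ?l ?T = ?S")
proof
  fix cp :: "'a chart \<times> 'a"
  obtain c p where cp: "cp = (c, p)" by (rule prod.exhaust)
  show "diag_restrict \<A> ?l ?T cp = ?S cp"
  proof (cases "c \<in> \<A> \<and> p \<in> cdom c")
    case False
    then show ?thesis by (auto simp: cp diag_restrict_def sum_cscale_apply symbol_outside)
  next
    case True
    let ?z = "coord c p"
    define Q where "Q = (\<lambda>e w. gauss_basis tensor e ((c, p), (c, param c w)))"
    have Q: "((\<lambda>w. Q e w / (?z - w) ^ ?l) \<longlongrightarrow> (if fst e = k then symbol e (c, p) else 0)) (at ?z)"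
      if e: "e \<in> gauss_index n k" for e
    proof -
      have le: "k \<le> fst e" using e by (auto simp: gauss_index_def)
      have "((\<lambda>w. Q e w / (?z - w) ^ (2 * fst e - 1) * (?z - w) ^ (2 * (fst e - k))) \<longlongrightarrow> 
          symbol e (c, p) * (?z - ?z) ^ (2 * (fst e - k))) (at ?z)"
        unfolding Q_def using True e by (intro tendsto_mult symbol_tendsto tendsto_power tendsto_diff tendsto_ident_at tendsto_const) auto
      moreover have "eventually (\<lambda>w. Q e w / (?z - w) ^ (2 * fst e - 1) * (?z - w) ^ (2 * (fst e - k)) = 
          Q e w / (?z - w) ^ ?l) (at ?z)"
        using eventually_neq_at_within[of ?z ?z UNIV]
      proof eventually_elim
        case (elim w)
        have "2 * fst e - 1 = ?l + 2 * (fst e - k)" using k le by simp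
        then show ?case using elim by (simp add: power_add)
      qed
      ultimately have "((\<lambda>w. Q e w / (?z - w) ^ ?l) \<longlongrightarrow> symbol e (c, p) * (?z - ?z) ^ (2 * (fst e - k))) (at ?z)"
        by (rule Lim_transform_eventually)
      moreover have "symbol e (c, p) * (?z - ?z) ^ (2 * (fst e - k)) = (if fst e = k then symbol e (c, p) else 0)"
        using le by simp
      ultimately show ?thesis by simp
    qed
    have "((\<lambda>w. \<Sum>e\<in>gauss_index n k. g e * (Q e w / (?z - w) ^ ?l)) \<longlongrightarrow>
        (\<Sum>e\<in>gauss_index n k. g e * (if fst e = k then symbol e (c, p) else 0))) (at ?z)"
      by (intro tendsto_sum tendsto_mult tendsto_const Q)
    moreover have "(\<lambda>w. \<Sum>e\<in>gauss_index n k. g e * (Q e w / (?z - w) ^ ?l)) = 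
        (\<lambda>w. ?T ((c, p), (c, param c w)) / (?z - w) ^ ?l)"
      by (simp add: sum_cscale_apply Q_def sum_divide_distrib)
    moreover have "(\<Sum>e\<in>gauss_index n k. g e * (if fst e = k then symbol e (c, p) else 0)) = ?S (c, p)"
      unfolding sum_cscale_apply by (rule sum.mono_neutral_cong_right) auto
    ultimately have "((\<lambda>w. ?T ((c, p), (c, param c w)) / (?z - w) ^ ?l) \<longlongrightarrow> ?S (c, p)) (at ?z)"
      by simp
    from tendsto_Lim[OF trivial_limit_at this] show ?thesis
      using True by (simp add: cp diag_restrict_def)
  qed
qed

text \<open>
  If \<open>x\<close> took finitely many values on a set accumulating at some point, it would fail to avoid one
  of them near this point. Hence discarding the zeros of \<open>x'\<close> and of \<open>\<omega>\<^sub>0\<close> leaves infinitely many values.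
\<close>

lemma infinitely_many_regular_values:
  obtains c S where "c \<in> \<A>" "S \<subseteq> cimg c" "infinite ((\<lambda>z. x (param c z)) ` S)"
    "\<forall>z\<in>S. param c z \<notin> poles \<A> x \<and> deriv (x \<circ> param c) z \<noteq> 0 \<and> form 0 (c, param c z) \<noteq> 0"
proof -
  obtain p where "p \<in> topspace X" using nonconstant by blast
  then obtain c where c: "c \<in> \<A>" "p \<in> cdom c" by (rule chart_exists)
  let ?f = "x \<circ> param c"
  define good where "good = (\<lambda>z. z \<in> cimg c \<and> param c z \<notin> poles \<A> x \<and> \<psi> (param c z) \<noteq> 0 \<and>
      form 0 (c, param c z) = coeff_fun c 0 z)"
  have "eventually good (at (coord c p))"
    using eventually_analytic_x[OF c] eventually_cubic[OF c] eventually_form[OF c, of 0] eventually_coeff[OF c, of 0]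
    unfolding good_def by eventually_elim auto
  then obtain U where U: "open U" "coord c p \<in> U" "\<And>z. z \<in> U \<Longrightarrow> z \<noteq> coord c p \<Longrightarrow> good z"
    unfolding eventually_at_topological by blast
  define V where "V = U - {coord c p}"
  have V: "open V" "\<And>z. z \<in> V \<Longrightarrow> good z" using U by (auto simp: V_def)
  have "U \<noteq> {coord c p}" using U(1) not_open_singleton by blast
  then have "V \<noteq> {}" using U(2) by (auto simp: V_def)
  then obtain z1 where z1: "z1 \<in> V" by blast
  have an: "?f analytic_on {z}" if "z \<in> V" for z
    using analytic_x[OF c(1) param_in_cdom[of z c]] V(2)[OF that] by (auto simp: good_def coord_param)
  have hol: "?f holomorphic_on V"
    using an by (intro analytic_imp_holomorphic) (simp add: analytic_on_analytic_at[of _ V])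
  have avoid: "eventually (\<lambda>w. ?f w \<noteq> a) (at z)" if "z \<in> V" for a z
    using eventually_avoids[OF c(1) param_in_cdom[of z c], of a] V(2)[OF that] by (simp add: good_def coord_param)
  \<comment> \<open>Otherwise \<open>x\<close> would be constant on a disc.\<close>
  have "\<exists>z\<in>V. deriv ?f z \<noteq> 0"
  proof (rule ccontr)
    assume "\<not> ?thesis"
    then have d: "deriv ?f z = 0" if "z \<in> V" for z using that by blast
    obtain r where r: "r > 0" "ball z1 r \<subseteq> V" using V(1) z1 by (auto simp: open_contains_ball)
    have "\<exists>a. \<forall>z\<in>ball z1 r. ?f z = a"
    proof (rule has_field_derivative_zero_constant[OF convex_ball, of z1 r])
      fix z assume "z \<in> ball z1 r"
      then have "(?f has_field_derivative 0) (at z)"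
        using holomorphic_derivI[OF hol V(1), of z] r(2) d[of z] by auto
      then show "(?f has_field_derivative 0) (at z within ball z1 r)"
        by (rule has_field_derivative_at_within)
    qed
    then obtain a where a: "\<forall>z\<in>ball z1 r. ?f z = a" by blast
    have "eventually (\<lambda>z. z \<in> ball z1 r) (at z1)"
      using r(1) by (intro eventually_at_in_open') auto
    with avoid[OF z1, of a] have "eventually (\<lambda>z. False) (at z1)"
      by eventually_elim (use a in auto)
    then show False by simp
  qed
  then obtain z2 where z2: "z2 \<in> V" "deriv ?f z2 \<noteq> 0" by blast
  define S where "S = {z \<in> V. deriv ?f z \<noteq> 0}"
  have "isCont (deriv ?f) z2"
    using holomorphic_deriv[OF hol V(1)] z2(1)
    continuous_on_eq_continuous_at[OF V(1), of "deriv ?f"] holomorphic_on_imp_continuous_on by blast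
  then have "eventually (\<lambda>z. deriv ?f z \<noteq> 0) (at z2)"
    using z2(2) by (intro tendsto_imp_eventually_ne[of _ "deriv ?f z2"]) (simp_all add: isCont_def)
  moreover have "eventually (\<lambda>z. z \<in> V) (at z2)"
    using V(1) z2(1) by (rule eventually_at_in_open')
  ultimately have ev: "eventually (\<lambda>z. z \<in> S) (at z2)"
    by eventually_elim (simp add: S_def)
  have inf: "infinite ((\<lambda>z. x (param c z)) ` S)"
  proof
    assume "finite ((\<lambda>z. x (param c z)) ` S)"
    then have "eventually (\<lambda>z. \<forall>a\<in>(\<lambda>z. x (param c z)) ` S. ?f z \<noteq> a) (at z2)"
      using avoid[OF z2(1)] by (intro eventually_ball_finite) auto
    with ev have "eventually (\<lambda>z. False) (at z2)"
      by eventually_elim auto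
    then show False by simp
  qed
  show ?thesis
  proof (rule that[OF c(1) _ inf])
    show "S \<subseteq> cimg c" using V(2) by (auto simp: S_def good_def)
    show "\<forall>z\<in>S. param c z \<notin> poles \<A> x \<and> deriv ?f z \<noteq> 0 \<and> form 0 (c, param c z) \<noteq> 0"
      using V(2) by (auto simp: S_def good_def coeff_fun_def)
  qed
qed

text \<open>
  On a set where \<open>x'\<close> and \<open>\<omega>\<^sub>0\<close> have no zeros, a combination of the leading terms is a polynomial in \<open>x\<close>
  times a nonvanishing factor, and \<open>x\<close> takes infinitely many values there.
\<close>

lemma symbols_independent:
  assumes zero: "(\<Sum>e\<in>{e \<in> gauss_index n k. fst e = k}. cscale (g e) (symbol e)) = 0"
  shows "\<forall>e\<in>{e \<in> gauss_index n k. fst e = k}. g e = 0"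
proof -
  let ?J = "{e \<in> gauss_index n k. fst e = k}"
  obtain c S where S: "c \<in> \<A>" "S \<subseteq> cimg c" "infinite ((\<lambda>z. x (param c z)) ` S)"
    "\<forall>z\<in>S. param c z \<notin> poles \<A> x \<and> deriv (x \<circ> param c) z \<noteq> 0 \<and> form 0 (c, param c z) \<noteq> 0"
    by (rule infinitely_many_regular_values)
  \<comment> \<open>The shift by 2 is the factor \<open>u v\<close> of the basis elements, restricted to the diagonal.\<close>
  define P where "P = (\<Sum>e\<in>?J. monom (g e) (snd e + 2))"
  have "poly P (x (param c z)) = 0" if z: "z \<in> S" for z
  proof -
    let ?p = "param c z"
    have zc: "z \<in> cimg c" using S(2) z by auto
    define C where "C = 2 * deriv (x \<circ> param c) z ^ (2 * k - 1) * form 0 (c, ?p) ^ 2"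
    have "(\<Sum>e\<in>?J. g e * symbol e (c, ?p)) = 0"
      using fun_cong[OF zero, of "(c, ?p)"] by (simp add: sum_cscale_apply)
    moreover have "symbol e (c, ?p) = C * x ?p ^ (snd e + 2)" if "e \<in> ?J" for e
      using symbol_finite[of c ?p k "snd e"] that S(1) bspec[OF S(4) z] zc by (cases e) (auto simp: C_def param_in_cdom coord_param)
    ultimately have "C * (\<Sum>e\<in>?J. g e * x ?p ^ (snd e + 2)) = 0"
      by (simp add: sum_distrib_left mult_ac)
    moreover have "C \<noteq> 0" using bspec[OF S(4) z] by (simp add: C_def)
    ultimately have "(\<Sum>e\<in>?J. g e * x ?p ^ (snd e + 2)) = 0"
      by simp
    then show ?thesis by (simp add: P_def poly_sum poly_monom)
  qed
  then have "(\<lambda>z. x (param c z)) ` S \<subseteq> {a. poly P a = 0}" by auto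
  then have "P = 0" using S(3) poly_roots_finite finite_subset by blast
  show ?thesis
  proof
    fix e assume e: "e \<in> ?J"
    have "coeff P (snd e + 2) = (\<Sum>e'\<in>?J. if e' = e then g e else 0)"
      unfolding P_def coeff_sum using e by (intro sum.cong) (auto simp: prod_eq_iff)
    also have "\<dots> = g e" using e by simp
    finally show "g e = 0" using \<open>P = 0\<close> by simp
  qed
qed

lemma gauss_index_restrict: "{e \<in> gauss_index n 1. k \<le> fst e} = gauss_index n k"
  by (auto simp: gauss_index_def)

lemma gauss_index_section: "1 \<le> k \<Longrightarrow> {e \<in> gauss_index n 1. fst e = k} = {e \<in> gauss_index n k. fst e = k}"
  by (auto simp: gauss_index_def)

sublocale filtered_family "gauss_index n 1" "gauss_basis tensor" symbol "\<lambda>k. diag_restrict \<A> (2 * k - 1)"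
proof
  show "1 \<le> fst e" if "e \<in> gauss_index n 1" for e using that by (auto simp: gauss_index_def)
  show "diag_restrict \<A> (2 * k - 1) (\<Sum>e\<in>{e \<in> gauss_index n 1. k \<le> fst e}. cscale (c e) (gauss_basis tensor e)) =
     (\<Sum>e\<in>{e \<in> gauss_index n 1. fst e = k}. cscale (c e) (symbol e))" if "1 \<le> k" for k c
    unfolding gauss_index_restrict gauss_index_section[OF that] using that by (rule diag_restrict_sum)
  show "\<forall>e\<in>{e \<in> gauss_index n 1. fst e = k}. c e = 0"
    if z: "(\<Sum>e\<in>{e \<in> gauss_index n 1. fst e = k}. cscale (c e) (symbol e)) = 0" for k c
  proof (cases "1 \<le> k")
    case True
    show ?thesis using symbols_independent z unfolding gauss_index_section[OF True] by blast
  qed (auto simp: gauss_index_def)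
qed simp

lemma holomorphic_formsD:
  assumes "\<omega> \<in> holomorphic_forms \<A>"
  shows "\<not> (c \<in> \<A> \<and> p \<in> cdom c) \<Longrightarrow> \<omega> (c, p) = 0"
    and "c \<in> \<A> \<Longrightarrow> (\<lambda>z. \<omega> (c, param c z)) holomorphic_on (cimg c)"
    and "c \<in> \<A> \<Longrightarrow> d \<in> \<A> \<Longrightarrow> p \<in> cdom c \<inter> cdom d \<Longrightarrow>
        \<omega> (d, p) = \<omega> (c, p) * deriv (coord c \<circ> param d) (coord d p)"
  using assms unfolding holomorphic_forms_def by blast+

lemma subspace_holomorphic_forms: "cfun.subspace (holomorphic_forms \<A>)"
proof (rule cfun.subspaceI)
  show "0 \<in> holomorphic_forms \<A>"
    by (simp add: holomorphic_forms_def)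
next
  fix v w assume v: "v \<in> holomorphic_forms \<A>" and w: "w \<in> holomorphic_forms \<A>"
  show "v + w \<in> holomorphic_forms \<A>"
    unfolding holomorphic_forms_def plus_fun_apply
  proof (intro CollectI conjI allI impI ballI)
    show "v (c, p) + w (c, p) = 0" if "\<not> (c \<in> \<A> \<and> p \<in> cdom c)" for c p
      using holomorphic_formsD(1)[OF v that] holomorphic_formsD(1)[OF w that] by simp
    show "(\<lambda>z. v (c, param c z) + w (c, param c z)) holomorphic_on cimg c" if "c \<in> \<A>" for c
      by (intro holomorphic_on_add holomorphic_formsD(2) v w that)
    show "v (d, p) + w (d, p) = (v (c, p) + w (c, p)) * deriv (coord c \<circ> param d) (coord d p)"
      if "c \<in> \<A>" "d \<in> \<A>" "p \<in> cdom c \<inter> cdom d" for c d p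
      unfolding holomorphic_formsD(3)[OF v that] holomorphic_formsD(3)[OF w that] by (rule distrib_right[symmetric])
  qed
next
  fix a v assume v: "v \<in> holomorphic_forms \<A>"
  show "cscale a v \<in> holomorphic_forms \<A>"
    unfolding holomorphic_forms_def cscale_def
  proof (intro CollectI conjI allI impI ballI)
    show "a * v (c, p) = 0" if "\<not> (c \<in> \<A> \<and> p \<in> cdom c)" for c p
      using holomorphic_formsD(1)[OF v that] by simp
    show "(\<lambda>z. a * v (c, param c z)) holomorphic_on cimg c" if "c \<in> \<A>" for c
      by (intro holomorphic_on_mult holomorphic_on_const holomorphic_formsD(2) v that)
    show "a * v (d, p) = a * v (c, p) * deriv (coord c \<circ> param d) (coord d p)"
      if "c \<in> \<A>" "d \<in> \<A>" "p \<in> cdom c \<inter> cdom d" for c d p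
      unfolding holomorphic_formsD(3)[OF v that] by (rule mult.assoc[symmetric])
  qed
qed

lemma subspace_H0_M: "cfun.subspace (H0_M \<A> x)"
proof -
  define Z where "Z = (\<lambda>c. {\<omega> :: 'a form. \<exists>h. h holomorphic_on (coord c ` (cdom c - poles \<A> x)) \<and>
       (\<forall>p\<in>cdom c - poles \<A> x. \<omega> (c, p) = x p * h (coord c p))})"
  have "cfun.subspace (Z c)" for c
  proof (rule cfun.subspaceI)
    show "0 \<in> Z c" by (auto simp: Z_def intro!: exI[of _ "\<lambda>_. 0"])
  next
    fix v w assume "v \<in> Z c" "w \<in> Z c"
    then obtain h h' where "h holomorphic_on coord c ` (cdom c - poles \<A> x)" 
        "\<forall>p\<in>cdom c - poles \<A> x. v (c, p) = x p * h (coord c p)"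
        "h' holomorphic_on coord c ` (cdom c - poles \<A> x)" 
        "\<forall>p\<in>cdom c - poles \<A> x. w (c, p) = x p * h' (coord c p)" 
      unfolding Z_def by blast
    then show "v + w \<in> Z c"
      unfolding Z_def by (intro CollectI exI[of _ "\<lambda>z. h z + h' z"]) (simp add: holomorphic_on_add algebra_simps)
  next
    fix a v assume "v \<in> Z c"
    then obtain h where "h holomorphic_on coord c ` (cdom c - poles \<A> x)" 
        "\<forall>p\<in>cdom c - poles \<A> x. v (c, p) = x p * h (coord c p)" 
      unfolding Z_def by blast
    then show "cscale a v \<in> Z c"
      unfolding Z_def cscale_def 
      by (intro CollectI exI[of _ "\<lambda>z. a * h z"]) (simp add: holomorphic_on_mult algebra_simps)
  qed
  then have "cfun.subspace (holomorphic_forms \<A> \<inter> (\<Inter>c\<in>\<A>. Z c))"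
    by (intro cfun.subspace_inter subspace_holomorphic_forms cfun.subspace_Int)
  also have "holomorphic_forms \<A> \<inter> (\<Inter>c\<in>\<A>. Z c) = H0_M \<A> x"
    by (auto simp: H0_M_def Z_def)
  finally show ?thesis .
qed

definition W_space :: "'a form set" where
  "W_space = cfun.span (form ` {1..n})"

lemma W_space_subset: "W_space \<subseteq> H0_M \<A> x"
  unfolding W_space_def by (rule cfun.span_minimal[OF _ subspace_H0_M]) (auto intro: form_in_H0_M)

lemma wedge_form: "wedge (form i) (form j) = tensor i j - tensor j i"
  by (auto simp: wedge_def tensor_def fun_eq_iff)

lemma Lambda2_W_space: "Lambda2 W_space = level 1"
proof
  have sub: "cfun.subspace {\<omega>. wedge \<omega> \<eta> \<in> level 1}" "cfun.subspace {\<omega>. wedge \<eta> \<omega> \<in> level 1}" for \<eta>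
  proof -
    have w: "wedge 0 \<eta> = 0" "wedge \<eta> 0 = 0" "wedge (u + v) \<eta> = wedge u \<eta> + wedge v \<eta>" 
      "wedge \<eta> (u + v) = wedge \<eta> u + wedge \<eta> v"
      "wedge (cscale a u) \<eta> = cscale a (wedge u \<eta>)" "wedge \<eta> (cscale a u) = cscale a (wedge \<eta> u)" for u v a
      by (auto simp: wedge_def cscale_def fun_eq_iff algebra_simps)
    show "cfun.subspace {\<omega>. wedge \<omega> \<eta> \<in> level 1}" "cfun.subspace {\<omega>. wedge \<eta> \<omega> \<in> level 1}"
      unfolding level_def
      by (rule cfun.subspaceI; simp only: mem_Collect_eq w cfun.span_zero cfun.span_add cfun.span_scale)+
  qed
  have "wedge (form i) (form j) \<in> level 1" if "i \<in> {1..n}" "j \<in> {1..n}" for i j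
    using antisym_in_span_gauss_basis[OF that, of tensor] unfolding wedge_form level_def gauss_index_restrict .
  then have "W_space \<subseteq> {\<eta>. wedge (form i) \<eta> \<in> level 1}" if "i \<in> {1..n}" for i
    unfolding W_space_def using that by (intro cfun.span_minimal sub) auto
  then have *: "wedge (form i) \<eta> \<in> level 1" if "i \<in> {1..n}" "\<eta> \<in> W_space" for i \<eta>
    using that by blast
  have "W_space \<subseteq> {\<omega>. wedge \<omega> \<eta> \<in> level 1}" if "\<eta> \<in> W_space" for \<eta>
    by (subst W_space_def, rule cfun.span_minimal[OF _ sub(1)]) (use * that in blast)
  then show "Lambda2 W_space \<subseteq> level 1"
    unfolding Lambda2_def by (intro cfun.span_minimal subspace_level) blast
  have "form i \<in> W_space" if "i \<in> {1..n}" for i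
    unfolding W_space_def using that by (intro cfun.span_base imageI)
  then have "tensor i j - tensor j i \<in> Lambda2 W_space" if "i \<in> {1..n}" "j \<in> {1..n}" for i j
    unfolding Lambda2_def wedge_form[symmetric] using that by (intro cfun.span_base) blast
  then have "gauss_basis tensor ` gauss_index n 1 \<subseteq> Lambda2 W_space"
    by (intro image_subsetI gauss_basis_in_subspace[of _ n]) (auto simp: Lambda2_def)
  then show "level 1 \<subseteq> Lambda2 W_space"
    unfolding level_def gauss_index_restrict by (intro cfun.span_minimal) (auto simp: Lambda2_def)
qed

text \<open>
  The domain \<open>gauss_ker\<close> is defined inside \<open>\<Lambda>\<^sup>2H\<^sup>0(M)\<close>; because \<open>W\<close> is contained in \<open>H\<^sup>0(M)\<close>, its
  intersection with \<open>\<Lambda>\<^sup>2W\<close> is computed by successive kernels on \<open>\<Lambda>\<^sup>2W\<close> itself.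
\<close>

lemma gauss_ker_W_space: "gauss_ker \<A> x k \<inter> Lambda2 W_space = level (Suc k)"
proof (induction k)
  case 0
  have "Lambda2 W_space \<subseteq> Lambda2 (H0_M \<A> x)"
    unfolding Lambda2_def using W_space_subset by (intro cfun.span_mono) blast
  then show ?case using Lambda2_W_space by auto
next
  case (Suc k)
  have "gauss_ker \<A> x (Suc k) \<inter> Lambda2 W_space = {T \<in> gauss_ker \<A> x k \<inter> Lambda2 W_space. diag_restrict \<A> (2 * Suc k - 1) T = 0}"
    by auto
  also have "\<dots> = level (Suc (Suc k))"
    unfolding Suc.IH by (rule kernel_on_level) simp
  finally show ?case .
qed

lemma mu_dom_W_space: "1 \<le> k \<Longrightarrow> mu_dom \<A> x k W_space = level k"
  using gauss_ker_W_space[of "k - 1"] by (simp add: mu_dom_def)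

lemma mu_rank_W_space:
  assumes "1 \<le> k"
  shows "mu_rank \<A> x k W_space = (if 2 * k \<le> n then 2 * (n - 2 * k) + 1 else 0)"
  unfolding mu_rank_def mu_dom_W_space[OF assms] dim_leading_image[OF assms]
    gauss_index_section[OF assms] by (rule card_gauss_index_section[OF assms])

lemma dim_mu_ker_W_space:
  assumes "1 \<le> k" "2 * k \<le> n"
  shows "2 * int (cfun.dim (mu_ker \<A> x k W_space)) = (int n - 2 * int k) * (int n - 1 - 2 * int k)"
proof -
  have "mu_ker \<A> x k W_space = level (Suc k)"
    unfolding mu_ker_def mu_dom_W_space[OF assms(1)] by (rule kernel_on_level[OF assms(1)])
  then have "cfun.dim (mu_ker \<A> x k W_space) = card (gauss_index n (Suc k))"
    by (simp only: dim_level gauss_index_restrict)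
  then show ?thesis
    using card_gauss_index[of "Suc k" n] assms by (simp add: algebra_simps)
qed

end

section \<open>Cyclic trigonal curves\<close>

lemma order_prod_linear:
  fixes t :: "nat \<Rightarrow> complex"
  assumes "finite I" "inj_on t I"
  shows "order a (\<Prod>m\<in>I. [:- t m, 1:]) \<le> 1"
  using assms
proof (induction I rule: finite_induct)
  case (insert k I)
  have nz: "[:- t k, 1:] * (\<Prod>m\<in>I. [:- t m, 1:]) \<noteq> 0"
    using insert.hyps by (intro no_zero_divisors) auto
  have "order a [:- t k, 1:] = (if a = t k then 1 else 0)"
    using order_power_n_n[of "t k" 1] by (auto intro: order_0I)
  moreover have "order (t k) (\<Prod>m\<in>I. [:- t m, 1:]) = 0"
    using insert.prems insert.hyps by (intro order_0I) (auto simp: poly_prod inj_on_def)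
  ultimately show ?case
    using insert order_mult[OF nz] by auto
qed simp

lemma degree_prod_linear:
  fixes t :: "nat \<Rightarrow> complex"
  shows "degree (\<Prod>m\<in>I. [:- t m, 1:]) = card I"
  by (subst degree_prod_eq_sum_degree) auto

text \<open>
  Applied to \<open>D = P Q\<^sup>2\<close> and \<open>D = P\<^sup>2 Q\<close> with \<open>P Q\<close> squarefree.
\<close>

lemma order_square_bound:
  fixes P Q D :: "complex poly"
  assumes "order a (P * Q) \<le> 1" "P * Q \<noteq> 0" "D dvd (P * Q) * (P * Q)"
  shows "order a D \<le> 2"
proof -
  have "order a D \<le> order a ((P * Q) * (P * Q))"
    using assms by (intro dvd_imp_order_le) auto
  also have "\<dots> = order a (P * Q) + order a (P * Q)"
    using assms by (intro order_mult) auto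
  finally show ?thesis using assms(1) by simp
qed

text \<open>
  Every value other than the branch points is taken by \<open>x\<close>, since the plane curve has points over it.
\<close>

lemma cyclic_trigonal_curve_imp_branched_cover:
  assumes curve: "cyclic_trigonal_curve r1 r2 t X \<A> x y"
  shows "branched_cover X \<A> x"
proof
  show "compact_riemann_surface X \<A>"
    using curve unfolding cyclic_trigonal_curve_def by (elim conjE)
  show "meromorphic_fun \<A> x"
    using curve unfolding cyclic_trigonal_curve_def by (elim conjE)
  fix a
  have "finite (insert a (t ` {1..r1+r2}))" by simp
  then obtain b where b: "b \<notin> insert a (t ` {1..r1+r2})"
    using ex_new_if_finite infinite_UNIV_char_0 by blast
  obtain w where w: "trigonal_rhs r1 r2 t b = w ^ 3"
    using exists_complex_root[of 3 "trigonal_rhs r1 r2 t b"] by auto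
  have "bij_betw (\<lambda>p. (x p, y p))
       {p \<in> topspace X - poles \<A> x. x p \<notin> t ` {1..r1+r2}}
       {(a, b). a \<notin> t ` {1..r1+r2} \<and> b ^ 3 = trigonal_rhs r1 r2 t a}" (is "bij_betw ?f ?P ?Q")
    using curve unfolding cyclic_trigonal_curve_def by (elim conjE)
  then have "?f ` ?P = ?Q" by (rule bij_betw_imp_surj_on)
  moreover have "(b, w) \<in> ?Q" using b w by simp
  ultimately have "(b, w) \<in> ?f ` ?P" by simp
  then obtain p where "p \<in> topspace X - poles \<A> x" "x p = b" by auto
  then show "\<exists>p\<in>topspace X - poles \<A> x. x p \<noteq> a" using b by auto
qed

text \<open>
  With \<open>P\<close> and \<open>Q\<close> the products over the simple and the double roots, \<open>y\<^sup>3 = P Q\<^sup>2\<close> at \<open>x\<close>. For \<open>i = 1\<close> take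
  \<open>\<psi> = 1/y\<close> and \<open>D = P Q\<^sup>2\<close>. For \<open>i = 2\<close> take \<open>\<psi> = Q/y\<^sup>2\<close>; its cube is \<open>Q\<^sup>3/(P Q\<^sup>2)\<^sup>2 = 1/(P\<^sup>2 Q)\<close>, so
  \<open>D = P\<^sup>2 Q\<close>, and the roles of the two kinds of branch points are interchanged.
\<close>

lemma cyclic_trigonal_curve_imp_cyclic_differentials:
  assumes curve: "cyclic_trigonal_curve r1 r2 t X \<A> x y" and i: "i \<in> {1, 2}"
  obtains \<psi> D where "cyclic_differentials X \<A> x \<psi> D (n_W r1 r2 i)"
    "W r1 r2 t \<A> x y i = cyclic_differentials.W_space \<A> x \<psi> (n_W r1 r2 i)"
proof -
  interpret branched_cover X \<A> x
    by (rule cyclic_trigonal_curve_imp_branched_cover[OF curve])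
  have inj: "inj_on t {1..r1+r2}"
    using curve unfolding cyclic_trigonal_curve_def by (elim conjE)
  have my: "meromorphic_fun \<A> y"
    using curve unfolding cyclic_trigonal_curve_def by (elim conjE)
  have eq: "\<forall>p\<in>topspace X - poles \<A> x. y p ^ 3 = trigonal_rhs r1 r2 t (x p)"
    using curve unfolding cyclic_trigonal_curve_def by (elim conjE)
  have meromorphic_y: "(y \<circ> param c) meromorphic_on cimg c" if "c \<in> \<A>" for c
    using my that unfolding meromorphic_fun_def nicely_meromorphic_on_def by blast
  define P Q where "P = (\<Prod>m\<in>{1..r1}. [:- t m, 1:])" and "Q = (\<Prod>m\<in>{r1+1..r1+r2}. [:- t m, 1:])"
  have nz: "P \<noteq> 0" "Q \<noteq> 0" by (auto simp: P_def Q_def)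
  have deg: "degree P = r1" "degree Q = r2" by (simp_all only: P_def Q_def degree_prod_linear) simp_all
  have "P * Q = (\<Prod>m\<in>{1..r1+r2}. [:- t m, 1:])"
    unfolding P_def Q_def by (subst prod.union_disjoint[symmetric]) (auto intro!: prod.cong)
  then have ord: "order a (P * Q) \<le> 1" for a
    using order_prod_linear[OF _ inj] by simp
  have y3: "y p ^ 3 = poly P (x p) * poly Q (x p) ^ 2" if "p \<in> topspace X - poles \<A> x" for p
    using eq that by (simp add: trigonal_rhs_def P_def Q_def poly_prod prod_power_distrib)
  have Q: "poly Q u = (\<Prod>m\<in>{r1+1..r1+r2}. u - t m)" for u
    by (simp add: Q_def poly_prod)
  show ?thesis
  proof (cases "i = 1")
    case True
    interpret cyclic_differentials X \<A> x "\<lambda>p. 1 / y p" "P * Q ^ 2" "n_W r1 r2 i"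
    proof
      show "((\<lambda>p. 1 / y p) \<circ> param c) meromorphic_on cimg c" if "c \<in> \<A>" for c
        using meromorphic_on_divide[OF meromorphic_on_const meromorphic_y[OF that]] by (simp add: o_def)
      show "(1 / y p) ^ 3 * poly (P * Q ^ 2) (x p) = 1"
        if "p \<in> topspace X - poles \<A> x" "poly (P * Q ^ 2) (x p) \<noteq> 0" for p
        using that(2) y3[OF that(1)] by (simp add: power_divide)
      show "P * Q ^ 2 \<noteq> 0" using nz by simp
      show "order a (P * Q ^ 2) \<le> 2" for a
        using ord nz by (intro order_square_bound[of a P Q]) (auto simp: power2_eq_square mult_ac)
      show "3 * n_W r1 r2 i + 3 < degree (P * Q ^ 2)" if "n_W r1 r2 i > 0"
        using that True nz by (simp add: n_W_def degree_mult_eq degree_power_eq deg)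
    qed
    have "W r1 r2 t \<A> x y i = W_space"
      unfolding W_space_def form_def by (simp add: True W_def)
    then show ?thesis using that cyclic_differentials_axioms by blast
  next
    case False
    then have i2: "i = 2" using i by simp
    interpret cyclic_differentials X \<A> x "\<lambda>p. poly Q (x p) / y p ^ 2" "P ^ 2 * Q" "n_W r1 r2 i"
    proof
      show "((\<lambda>p. poly Q (x p) / y p ^ 2) \<circ> param c) meromorphic_on cimg c" if "c \<in> \<A>" for c
      proof -
        have "(\<lambda>z. (\<Prod>m\<in>{r1+1..r1+r2}. (x \<circ> param c) z - t m) / (y \<circ> param c) z ^ 2) meromorphic_on cimg c"
          by (intro meromorphic_on_divide meromorphic_on_prod meromorphic_on_diff meromorphic_on_power
              meromorphic_on_const meromorphic_x[OF that] meromorphic_y[OF that])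
        then show ?thesis by (simp add: o_def Q)
      qed
      show "(poly Q (x p) / y p ^ 2) ^ 3 * poly (P ^ 2 * Q) (x p) = 1"
        if "p \<in> topspace X - poles \<A> x" "poly (P ^ 2 * Q) (x p) \<noteq> 0" for p
      proof -
        have "(y p ^ 2) ^ 3 = (y p ^ 3) ^ 2" by (simp flip: power_mult)
        also have "\<dots> = poly Q (x p) ^ 3 * poly (P ^ 2 * Q) (x p)"
          unfolding y3[OF that(1)] by (simp add: power_mult_distrib power2_eq_square power3_eq_cube)
        finally show ?thesis using that(2) by (simp add: power_divide)
      qed
      show "P ^ 2 * Q \<noteq> 0" using nz by simp
      show "order a (P ^ 2 * Q) \<le> 2" for a
        using ord nz by (intro order_square_bound[of a P Q]) (auto simp: power2_eq_square mult_ac)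
      show "3 * n_W r1 r2 i + 3 < degree (P ^ 2 * Q)" if "n_W r1 r2 i > 0"
        using that i2 nz by (simp add: n_W_def degree_mult_eq degree_power_eq deg)
    qed
    have "W r1 r2 t \<A> x y i = W_space"
      unfolding W_space_def form_def by (simp add: i2 W_def Q)
    then show ?thesis using that cyclic_differentials_axioms by blast
  qed
qed

theorem theorem2p8:
  fixes r1 r2 i :: nat and t :: "nat \<Rightarrow> complex"
    and X :: "'a topology" and \<A> :: "'a chart set" and x y :: "'a \<Rightarrow> complex"
  assumes "cyclic_trigonal_curve r1 r2 t X \<A> x y"
    and "genus \<A> \<ge> 16"
    and "i \<in> {1, 2}"
  shows "(\<forall>k. 2 \<le> k \<and> k \<le> n_W r1 r2 i div 2 \<longrightarrow>
            int (mu_rank \<A> x k (W r1 r2 t \<A> x y i)) = 2 * int (n_W r1 r2 i) - 4 * int k + 1 \<and>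
            real (cfun.dim (mu_ker \<A> x k (W r1 r2 t \<A> x y i))) =
              real (n_W r1 r2 i) * (real (n_W r1 r2 i) - 1) / 2
                - real k * (2 * real (n_W r1 r2 i) - 2 * real k - 1)) \<and>
         (\<forall>k. k > n_W r1 r2 i div 2 \<longrightarrow> mu_rank \<A> x k (W r1 r2 t \<A> x y i) = 0)"
proof -
  define n where "n = n_W r1 r2 i"
  obtain \<psi> D where "cyclic_differentials X \<A> x \<psi> D n"
    and W: "W r1 r2 t \<A> x y i = cyclic_differentials.W_space \<A> x \<psi> n"
    using cyclic_trigonal_curve_imp_cyclic_differentials[OF assms(1,3)] unfolding n_def by blast
  then interpret cyclic_differentials X \<A> x \<psi> D n by simp
  show ?thesis
    unfolding W n_def[symmetric]
  proof (intro conjI allI impI)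
    fix k assume "2 \<le> k \<and> k \<le> n div 2"
    then have k: "1 \<le> k" "2 * k \<le> n" by auto
    show "int (mu_rank \<A> x k W_space) = 2 * int n - 4 * int k + 1"
      using k by (simp add: mu_rank_W_space of_nat_diff)
    have "real_of_int (2 * int (cfun.dim (mu_ker \<A> x k W_space))) =
        real_of_int ((int n - 2 * int k) * (int n - 1 - 2 * int k))"
      by (simp only: dim_mu_ker_W_space[OF k])
    then show "real (cfun.dim (mu_ker \<A> x k W_space)) =
        real n * (real n - 1) / 2 - real k * (2 * real n - 2 * real k - 1)"
      by (simp add: field_simps)
  next
    fix k assume "n div 2 < k"
    then show "mu_rank \<A> x k W_space = 0"
      by (subst mu_rank_W_space) auto
  qed
qed

end
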